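(* Let $X$ be a completely metrizable space. Then the following are equivalent: (i) $X$ is $2^\omega$-partitionable; (ii) $X$ is $2^\omega$-coverable; (iii) $X$ has no isolated points.
   Context: No separability or cardinality restriction is assumed. $2^\omega$ denotes the Cantor space. A space $X$ is $2^\omega$-partitionable if there is a partition of $X$ (a family of pairwise disjoint subsets with union $X$) each member of which, with the subspace topology, is homeomorphic to $2^\omega$. A space $X$ is $2^\omega$-coverable if there is a family of subsets of $X$ with union $X$, each member of which, with the subspace topology, is homeomorphic to $2^\omega$. *)

theory Defs
  imports "HOL-Analysis.Analysis"
begin

definition cantor_space :: "(nat \<Rightarrow> bool) topology" where
  "cantor_space = product_topology (\<lambda>_. discrete_topology UNIV) UNIV"

text \<open>
  In both definitions below every member of the family is contained in the carrier of
  \<open>X\<close>, so \<open>subtopology X C\<close> is the subspace topology on all of \<open>C\<close>. The requirement of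
  \<open>partition_on\<close> that the parts be nonempty is no restriction, since the Cantor space is
  nonempty.
\<close>

definition cantor_partitionable :: "'a topology \<Rightarrow> bool" where
  "cantor_partitionable X \<longleftrightarrow>
     (\<exists>P. partition_on (topspace X) P \<and>
          (\<forall>C\<in>P. subtopology X C homeomorphic_space cantor_space))"

definition cantor_coverable :: "'a topology \<Rightarrow> bool" where
  "cantor_coverable X \<longleftrightarrow>
     (\<exists>F. \<Union>F = topspace X \<and>
          (\<forall>C\<in>F. subtopology X C homeomorphic_space cantor_space))"

definition isolated_point :: "'a topology \<Rightarrow> 'a \<Rightarrow> bool" where
  "isolated_point X x \<longleftrightarrow> x \<in> topspace X \<and> openin X {x}"

end

(*
  Fix a complete metric and split X successively into F_sigma pieces of vanishing diameter, the
  closure of each piece lying inside the previous one. This makes X a tree of pieces in which every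
  branch converges to a point of its pieces. Choosing nodes with the least number of nodes below
  them, one peels off (by Zorn's lemma) closed sets that are either singletons or uniform, meaning
  that no branch is isolated and all nodes have the same number kappa of nodes below them. In a
  uniform set every node splits, up to at most one point, into exactly kappa disjoint nodes;
  identifying kappa with kappa x 2 and fixing the kappa-coordinates of a branch gives a Cantor set,
  and these Cantor sets are disjoint. The points E left over form a countable union of uniformly discrete sets, so by
  Baire the Cantor sets are dense. Finally each x in E is absorbed: disjoint small Cantor sets
  converging to x, cut out of the given ones, form a Cantor set together with x. They are taken
  from distinct members of a partition of each given Cantor set into continuum many Cantor sets,
  so that what remains of each member is still a disjoint union of Cantor sets.
*)
theory Submission
  imports Defs
begin

unbundle cardinal_syntax

section \<open>Cantor sets in topological spaces\<close>

text \<open>Two obstacles shape the construction. First, a connected space has no nontrivial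
  partition into open sets, so the pieces cannot be clopen. F_sigma pieces suffice: sorting the
  points of a piece by the first closed set that contains them, in a sequence of closed sets with
  union the piece, keeps the closure of each part inside the piece. Second, kappa may exceed the
  size of every single level, as it does for kappa = aleph_0 with finite levels. Then the kappa
  children of a node are collected from ever deeper levels along the branch of one point, which is
  itself missed. The missed points, together with the singletons met in peeling, are the set E.
  Having exactly kappa children everywhere means that one index set, kappa x 2, labels the children
  of all nodes, so the kappa-coordinates can be fixed independently of the branch. That E is a
  countable union of uniformly discrete sets rests on each level of pieces being
  sigma-discrete.\<close>

definition agree :: "nat \<Rightarrow> (nat \<Rightarrow> bool) \<Rightarrow> (nat \<Rightarrow> bool) \<Rightarrow> bool" where
  "agree n b b' \<longleftrightarrow> (\<forall>i<n. b' i = b i)"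

lemma agree_refl [simp]: "agree n b b"
  by (simp add: agree_def)

lemma agree_trans: "agree n a b \<Longrightarrow> agree n b c \<Longrightarrow> agree n a c"
  by (simp add: agree_def)

lemma openin_cantor_space:
  "openin cantor_space U \<longleftrightarrow> (\<forall>b\<in>U. \<exists>n. \<forall>b'. agree n b b' \<longrightarrow> b' \<in> U)"
proof
  assume U: "openin cantor_space U"
  show "\<forall>b\<in>U. \<exists>n. \<forall>b'. agree n b b' \<longrightarrow> b' \<in> U"
  proof
    fix b assume "b \<in> U"
    with U have "\<exists>V. finite {i \<in> UNIV. V i \<noteq> topspace (discrete_topology UNIV)} \<and>
        (\<forall>i\<in>UNIV. openin (discrete_topology UNIV) (V i)) \<and> b \<in> Pi\<^sub>E UNIV V \<and> Pi\<^sub>E UNIV V \<subseteq> U"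
      unfolding cantor_space_def openin_product_topology_alt by (elim bspec)
    then obtain V where V: "finite {i. V i \<noteq> UNIV}" "b \<in> Pi\<^sub>E UNIV V" "Pi\<^sub>E UNIV V \<subseteq> U"
      by (elim exE conjE) simp
    obtain n where n: "\<And>i. V i \<noteq> UNIV \<Longrightarrow> i < n"
      using V(1) unfolding finite_nat_set_iff_bounded by blast
    have "b' \<in> U" if "agree n b b'" for b'
    proof -
      have "b' i \<in> V i" for i
        using n[of i] that V(2) unfolding agree_def by (cases "V i = UNIV") (auto simp: PiE_iff)
      then show ?thesis using V(3) by (auto simp: PiE_iff)
    qed
    then show "\<exists>n. \<forall>b'. agree n b b' \<longrightarrow> b' \<in> U" by blast
  qed
next
  assume U: "\<forall>b\<in>U. \<exists>n. \<forall>b'. agree n b b' \<longrightarrow> b' \<in> U"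
  show "openin cantor_space U"
    unfolding cantor_space_def openin_product_topology_alt
  proof (intro conjI ballI)
    fix b assume "b \<in> U"
    then obtain n where n: "\<And>b'. agree n b b' \<Longrightarrow> b' \<in> U"
      using U by blast
    define V where "V i = (if i < n then {b i} else UNIV)" for i
    have "finite {i. V i \<noteq> UNIV}"
      by (rule finite_subset[of _ "{..<n}"]) (auto simp: V_def)
    moreover have "b \<in> Pi\<^sub>E UNIV V" by (auto simp: V_def)
    moreover have "Pi\<^sub>E UNIV V \<subseteq> U"
    proof
      fix b' assume "b' \<in> Pi\<^sub>E UNIV V"
      then have "b' i \<in> V i" for i by auto
      then have "b' i = b i" if "i < n" for i using that unfolding V_def by (metis singletonD)
      then show "b' \<in> U" by (intro n) (simp add: agree_def)
    qed
    ultimately show "\<exists>Ua. finite {i \<in> UNIV. Ua i \<noteq> topspace (discrete_topology UNIV)} \<and>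
              (\<forall>i\<in>UNIV. openin (discrete_topology UNIV) (Ua i)) \<and> b \<in> Pi\<^sub>E UNIV Ua \<and> Pi\<^sub>E UNIV Ua \<subseteq> U"
      by (intro exI[of _ V]) auto
  qed
qed

lemma topspace_cantor_space [simp]: "topspace cantor_space = UNIV"
  by (simp add: cantor_space_def)

lemma compact_space_cantor_space: "compact_space cantor_space"
  unfolding cantor_space_def compact_space_product_topology
  by (simp add: compact_space_discrete_topology)

lemma cantor_space_no_isolated: "\<not> openin cantor_space {b}"
proof
  assume "openin cantor_space {b}"
  then obtain n where n: "\<And>b'. agree n b b' \<Longrightarrow> b' = b"
    unfolding openin_cantor_space by blast
  have "b(n := \<not> b n) = b" by (rule n) (auto simp: agree_def)
  then show False by (metis fun_upd_same)
qed

text \<open>Compactness of the Cantor space makes such a map an embedding whenever \<open>X\<close>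
  is Hausdorff, so only injectivity and continuity have to be checked.\<close>

definition cantor_emb :: "'a topology \<Rightarrow> ((nat \<Rightarrow> bool) \<Rightarrow> 'a) \<Rightarrow> bool" where
  "cantor_emb X h \<longleftrightarrow> inj h \<and> continuous_map cantor_space X h"

text \<open>The form relative to a subset permits gluing of disjoint parts. The empty set qualifies,
  which covers the removal of a cylinder of length 0.\<close>

definition cantor_decomposable :: "'a topology \<Rightarrow> 'a set \<Rightarrow> bool" where
  "cantor_decomposable X Y \<longleftrightarrow>
     (\<exists>P. partition_on Y P \<and> (\<forall>C\<in>P. subtopology X C homeomorphic_space cantor_space))"

lemma cantor_emb_homeomorphic:
  assumes "Hausdorff_space X" "cantor_emb X h"
  shows "subtopology X (range h) homeomorphic_space cantor_space"
proof -
  have "embedding_map cantor_space X h"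
    using assms continuous_imp_embedding_map[of cantor_space X h] compact_space_cantor_space
    by (auto simp: cantor_emb_def)
  then show ?thesis
    using embedding_map_imp_homeomorphic_space homeomorphic_space_sym by fastforce
qed

lemma cantor_decomposable_range:
  assumes "Hausdorff_space X" "cantor_emb X h"
  shows "cantor_decomposable X (range h)"
  unfolding cantor_decomposable_def
  by (rule exI[of _ "{range h}"])
     (use cantor_emb_homeomorphic[OF assms] in \<open>auto simp: partition_on_def disjoint_def\<close>)

lemma cantor_decomposable_UN:
  assumes dec: "\<And>i. i \<in> I \<Longrightarrow> cantor_decomposable X (A i)"
    and disj: "\<And>i j. i \<in> I \<Longrightarrow> j \<in> I \<Longrightarrow> i \<noteq> j \<Longrightarrow> A i \<inter> A j = {}"
  shows "cantor_decomposable X (\<Union>i\<in>I. A i)"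
proof -
  obtain P where P: "\<And>i. i \<in> I \<Longrightarrow> partition_on (A i) (P i)"
      "\<And>i C. i \<in> I \<Longrightarrow> C \<in> P i \<Longrightarrow> subtopology X C homeomorphic_space cantor_space"
    using dec unfolding cantor_decomposable_def by metis
  have sub: "C \<subseteq> A i" "C \<noteq> {}" if "i \<in> I" "C \<in> P i" for i C
    using P(1)[OF that(1)] that(2) by (auto simp: partition_on_def)
  have "partition_on (\<Union>i\<in>I. A i) (\<Union>i\<in>I. P i)"
  proof (rule partition_onI)
    show "\<Union> (\<Union>i\<in>I. P i) = (\<Union>i\<in>I. A i)"
      using P(1) by (fastforce simp: partition_on_def)
    show "disjnt p p'" if p: "p \<in> (\<Union>i\<in>I. P i)" "p' \<in> (\<Union>i\<in>I. P i)" "p \<noteq> p'" for p p'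
    proof -
      obtain i j where ij: "i \<in> I" "p \<in> P i" "j \<in> I" "p' \<in> P j" using p(1,2) by blast
      show ?thesis
      proof (cases "i = j")
        case True
        then show ?thesis using P(1)[OF ij(1)] ij p(3)
          by (auto simp: partition_on_def disjoint_def disjnt_def)
      next
        case False
        then show ?thesis using disj[OF ij(1,3)] sub(1)[OF ij(1,2)] sub(1)[OF ij(3,4)]
          by (auto simp: disjnt_def)
      qed
    qed
    show "{} \<notin> (\<Union>i\<in>I. P i)" using sub(2) by blast
  qed
  then show ?thesis unfolding cantor_decomposable_def using P(2) by blast
qed

section \<open>Cylinders and fibres of the Cantor space\<close>

definition cons_prefix :: "nat \<Rightarrow> (nat \<Rightarrow> bool) \<Rightarrow> (nat \<Rightarrow> bool) \<Rightarrow> nat \<Rightarrow> bool" where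
  "cons_prefix n p w = (\<lambda>i. if i < n then p i else w (i - n))"

text \<open>For fixed \<open>z\<close> the sequences \<open>weave z w\<close> form a Cantor set, and
  as \<open>z\<close> varies these fibres partition the Cantor space into continuum many Cantor
  sets.\<close>

definition weave :: "(nat \<Rightarrow> bool) \<Rightarrow> (nat \<Rightarrow> bool) \<Rightarrow> nat \<Rightarrow> bool" where
  "weave z w = (\<lambda>i. if even i then w (i div 2) else z (i div 2))"

lemma inj_cons_prefix: "inj (cons_prefix n p)"
proof (rule injI, rule ext)
  fix w w' i assume "cons_prefix n p w = cons_prefix n p w'"
  from fun_cong[OF this, of "i + n"] show "w i = w' i" by (simp add: cons_prefix_def)
qed

lemma range_cons_prefix: "range (cons_prefix n p) = {b. \<forall>i<n. b i = p i}"
proof -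
  have "b \<in> range (cons_prefix n p)" if "\<forall>i<n. b i = p i" for b
    by (rule range_eqI[of _ _ "\<lambda>i. b (i + n)"]) (use that in \<open>auto simp: cons_prefix_def\<close>)
  moreover have "\<forall>i<n. b i = p i" if "b \<in> range (cons_prefix n p)" for b
    using that by (auto simp: cons_prefix_def)
  ultimately show ?thesis by blast
qed

lemma weave_eq_iff: "weave z w = weave z' w' \<longleftrightarrow> z = z' \<and> w = w'"
proof
  assume e: "weave z w = weave z' w'"
  have "w i = w' i" for i using fun_cong[OF e, of "2 * i"] by (simp add: weave_def)
  moreover have "z i = z' i" for i using fun_cong[OF e, of "2 * i + 1"] by (simp add: weave_def)
  ultimately show "z = z' \<and> w = w'" by blast
qed auto

lemma weave_split: "weave (\<lambda>i. b (2 * i + 1)) (\<lambda>i. b (2 * i)) = b"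
proof
  fix i show "weave (\<lambda>i. b (2 * i + 1)) (\<lambda>i. b (2 * i)) i = b i"
    by (cases "even i") (auto simp: weave_def elim: oddE)
qed

lemma continuous_map_cantorI:
  assumes "\<And>b n. \<exists>m. \<forall>b'. agree m b b' \<longrightarrow> agree n (f b) (f b')"
  shows "continuous_map cantor_space cantor_space f"
  unfolding continuous_map_def
proof (intro conjI allI impI)
  fix U assume U: "openin cantor_space U"
  show "openin cantor_space {x \<in> topspace cantor_space. f x \<in> U}"
    unfolding openin_cantor_space
  proof
    fix b assume "b \<in> {x \<in> topspace cantor_space. f x \<in> U}"
    then obtain n where n: "\<And>b'. agree n (f b) b' \<Longrightarrow> b' \<in> U"
      using U unfolding openin_cantor_space by blast
    obtain m where m: "\<forall>b'. agree m b b' \<longrightarrow> agree n (f b) (f b')"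
      using assms by blast
    show "\<exists>n. \<forall>b'. agree n b b' \<longrightarrow> b' \<in> {x \<in> topspace cantor_space. f x \<in> U}"
    proof (intro exI[of _ m] allI impI CollectI conjI)
      fix b' assume "agree m b b'"
      then have "agree n (f b) (f b')" using m by blast
      then show "f b' \<in> U" by (rule n)
    qed simp
  qed
qed auto

lemma continuous_cons_prefix: "continuous_map cantor_space cantor_space (cons_prefix n p)"
  by (rule continuous_map_cantorI) (rule_tac x=na in exI, auto simp: cons_prefix_def agree_def)

lemma continuous_weave: "continuous_map cantor_space cantor_space (weave z)"
  by (rule continuous_map_cantorI) (rule_tac x=n in exI, auto simp: weave_def agree_def)

lemma cantor_emb_cons_prefix: "cantor_emb X h \<Longrightarrow> cantor_emb X (\<lambda>w. h (cons_prefix n p w))"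
  unfolding cantor_emb_def
  using continuous_map_compose[OF continuous_cons_prefix, of X h n p] inj_compose[OF _ inj_cons_prefix, of h n p]
  by (auto simp: o_def)

lemma cantor_emb_weave: "cantor_emb X h \<Longrightarrow> cantor_emb X (\<lambda>w. h (weave z w))"
  unfolding cantor_emb_def
  using continuous_map_compose[OF continuous_weave, of X h z] 
  by (auto simp: o_def inj_def) (metis weave_eq_iff)

text \<open>A sequence outside the cylinder has a first place \<open>j < n\<close> where it leaves
  \<open>p\<close>. Sorting by \<open>j\<close> splits the complement into \<open>n\<close> disjoint
  cylinders, the images of which are the sets \<open>A j\<close>.\<close>

lemma cantor_decomposable_remove_cylinder:
  assumes X: "Hausdorff_space X" and h: "cantor_emb X h"
  shows "cantor_decomposable X (range h - range (\<lambda>w. h (cons_prefix n p w)))"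
proof -
  define q where "q j = p(j := \<not> p j)" for j
  define A where "A j = range (\<lambda>w. h (cons_prefix (Suc j) (q j) w))" for j
  have A: "A j = h ` {b. \<forall>i<Suc j. b i = q j i}" for j
    unfolding A_def range_cons_prefix[symmetric] by auto
  have ih: "inj h" using h by (simp add: cantor_emb_def)
  have "range h - range (\<lambda>w. h (cons_prefix n p w)) = h ` (UNIV - {b. \<forall>i<n. b i = p i})"
    unfolding range_cons_prefix[symmetric] using ih by (auto simp: inj_def)
  also have "UNIV - {b. \<forall>i<n. b i = p i} = (\<Union>j<n. {b. \<forall>i<Suc j. b i = q j i})"
  proof (intro equalityI subsetI)
    fix b assume "b \<in> UNIV - {b. \<forall>i<n. b i = p i}"
    then obtain i where i: "i < n" "b i \<noteq> p i" by auto
    define j where "j = (LEAST i. b i \<noteq> p i)"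
    have j: "b j \<noteq> p j" "j \<le> i" "\<And>i. i < j \<Longrightarrow> b i = p i"
      unfolding j_def using LeastI[of "\<lambda>i. b i \<noteq> p i", OF i(2)] Least_le[of "\<lambda>i. b i \<noteq> p i", OF i(2)]
        not_less_Least[of _ "\<lambda>i. b i \<noteq> p i"] by blast+
    have "b \<in> {b. \<forall>i<Suc j. b i = q j i}" using j by (auto simp: q_def less_Suc_eq)
    then show "b \<in> (\<Union>j<n. {b. \<forall>i<Suc j. b i = q j i})" using j(2) i(1) by auto
  next
    fix b assume "b \<in> (\<Union>j<n. {b. \<forall>i<Suc j. b i = q j i})"
    then obtain j where j: "j < n" "\<forall>i<Suc j. b i = q j i" by blast
    then have "b j \<noteq> p j" by (simp add: q_def)
    with j(1) show "b \<in> UNIV - {b. \<forall>i<n. b i = p i}" by blast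
  qed
  also have "h ` \<dots> = (\<Union>j<n. A j)" by (auto simp: A)
  finally have eq: "range h - range (\<lambda>w. h (cons_prefix n p w)) = (\<Union>j\<in>{..<n}. A j)" by simp
  have disj: "A i \<inter> A j = {}" if "i < j" for i j
  proof -
    have "{b. \<forall>k<Suc i. b k = q i k} \<inter> {b. \<forall>k<Suc j. b k = q j k} = {}"
    proof -
      have False if "\<forall>k<Suc i. b k = q i k" "\<forall>k<Suc j. b k = q j k" for b
        using spec[OF that(1), of i] spec[OF that(2), of i] \<open>i < j\<close> by (simp add: q_def)
      then show ?thesis by blast
    qed
    then show ?thesis unfolding A using image_Int[OF ih] by (metis image_empty)
  qed
  show ?thesis unfolding eq
  proof (rule cantor_decomposable_UN)
    show "cantor_decomposable X (A i)" for i
      unfolding A_def by (rule cantor_decomposable_range[OF X cantor_emb_cons_prefix[OF h]])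
    show "A i \<inter> A j = {}" if "i \<noteq> j" for i j
      using disj[of i j] disj[of j i] that by (cases "i < j") auto
  qed
qed

lemma (in Metric_space) continuous_map_cantor_metric:
  "continuous_map cantor_space mtopology h \<longleftrightarrow>
     range h \<subseteq> M \<and> (\<forall>b. \<forall>e>0. \<exists>n. \<forall>b'. agree n b b' \<longrightarrow> d (h b) (h b') < e)"
  (is "_ \<longleftrightarrow> ?R")
proof
  assume c: "continuous_map cantor_space mtopology h"
  then have r: "range h \<subseteq> M" by (auto simp: continuous_map_def)
  have "\<exists>n. \<forall>b'. agree n b b' \<longrightarrow> d (h b) (h b') < e" if e: "e > 0" for b e
  proof -
    obtain U where U: "openin cantor_space U" "b \<in> U" "\<forall>y\<in>U. h y \<in> mball (h b) e"
      using c[unfolded continuous_map_to_metric, rule_format, of b e] e by auto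
    have "\<exists>n. \<forall>b'. agree n b b' \<longrightarrow> b' \<in> U"
      using U(1) U(2) unfolding openin_cantor_space by (rule bspec)
    then obtain n where n: "\<And>b'. agree n b b' \<Longrightarrow> b' \<in> U"
      by blast
    have "d (h b) (h b') < e" if "agree n b b'" for b'
      using n[OF that] U(3) by simp
    then show ?thesis by blast
  qed
  then show ?R using r by (intro conjI allI impI)
next
  assume R: ?R
  then have rM: "h b \<in> M" for b by auto
  show "continuous_map cantor_space mtopology h"
    unfolding continuous_map_to_metric
  proof (intro ballI allI impI)
    fix b :: "nat \<Rightarrow> bool" and e :: real assume "e > 0"
    with R have "\<exists>n. \<forall>b'. agree n b b' \<longrightarrow> d (h b) (h b') < e"
      by (elim conjE allE[of _ b] allE[of _ e]) (rule mp)
    then obtain n where n: "\<forall>b'. agree n b b' \<longrightarrow> d (h b) (h b') < e" ..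
    show "\<exists>U. openin cantor_space U \<and> b \<in> U \<and> (\<forall>y\<in>U. h y \<in> mball (h b) e)"
    proof (intro exI[of _ "{b'. agree n b b'}"] conjI ballI)
      show "openin cantor_space {b'. agree n b b'}"
        unfolding openin_cantor_space using agree_trans by (intro ballI exI[of _ n]) blast
      show "h y \<in> mball (h b) e" if "y \<in> {b'. agree n b b'}" for y
        using that n rM by simp
    qed simp
  qed
qed

section \<open>Trees of partitions\<close>

lemma card_of_finite_ordLess_infinite: "finite A \<Longrightarrow> infinite B \<Longrightarrow> |A| <o |B|"
  by (rule finite_ordLess_infinite) (auto simp: card_of_well_order_on Field_card_of)

text \<open>Convergence along branches, stated without a metric: \<open>N n x\<close> is the piece
  of level \<open>n\<close> around \<open>x\<close>. In \<open>N_complete\<close> the points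
  \<open>s n\<close> mark a descending sequence of pieces \<open>N n (s n)\<close>, and the
  conclusion puts \<open>x\<close> into all of them; by \<open>N_sep\<close> this \<open>x\<close>
  is unique.\<close>

locale refining_partitions =
  fixes M :: "'a set" and N :: "nat \<Rightarrow> 'a \<Rightarrow> 'a set"
  assumes N_sub: "x \<in> M \<Longrightarrow> N n x \<subseteq> M"
    and N_self: "x \<in> M \<Longrightarrow> x \<in> N n x"
    and N_eq: "x \<in> M \<Longrightarrow> y \<in> N n x \<Longrightarrow> N n y = N n x"
    and N_Suc: "x \<in> M \<Longrightarrow> N (Suc n) x \<subseteq> N n x"
    and N_0: "x \<in> M \<Longrightarrow> N 0 x = M"
    and N_complete: "(\<And>n. s n \<in> M) \<Longrightarrow> (\<And>n. s (Suc n) \<in> N n (s n)) \<Longrightarrow> \<exists>x\<in>M. \<forall>n. s n \<in> N n x"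
    and N_sep: "x \<in> M \<Longrightarrow> (\<And>n. y \<in> N n x) \<Longrightarrow> y = x"
begin

lemma N_mono: "x \<in> M \<Longrightarrow> m \<le> n \<Longrightarrow> N n x \<subseteq> N m x"
  by (induction n) (use N_Suc le_Suc_eq in \<open>blast+\<close>)

lemma N_eq': "x \<in> M \<Longrightarrow> y \<in> M \<Longrightarrow> N n x \<inter> N n y \<noteq> {} \<Longrightarrow> N n x = N n y"
  using N_eq by blast

text \<open>The level is stored because a piece may be the same set at several levels. Even a single
  point then has infinitely many nodes, so the number of nodes of a nonempty set is an infinite
  cardinal.\<close>

definition nodes :: "'a set \<Rightarrow> (nat \<times> 'a set) set" where
  "nodes U = (\<Union>n. {n} \<times> N n ` U)"

lemma nodesI: "x \<in> U \<Longrightarrow> (n, N n x) \<in> nodes U"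
  by (auto simp: nodes_def)

lemma nodesE: "s \<in> nodes U \<Longrightarrow> (\<And>n x. x \<in> U \<Longrightarrow> s = (n, N n x) \<Longrightarrow> P) \<Longrightarrow> P"
  by (auto simp: nodes_def)

lemma nodes_mono: "U \<subseteq> V \<Longrightarrow> nodes U \<subseteq> nodes V"
  by (auto simp: nodes_def)

lemma infinite_nodes: "x \<in> U \<Longrightarrow> infinite (nodes U)"
proof
  assume x: "x \<in> U" and f: "finite (nodes U)"
  have "range (\<lambda>n. (n, N n x)) \<subseteq> nodes U" using x by (auto intro: nodesI)
  then have "finite (range (\<lambda>n. (n, N n x)))" using f finite_subset by blast
  moreover have "inj (\<lambda>n. (n, N n x))" by (auto simp: inj_def)
  ultimately show False using finite_imageD by blast
qed

section \<open>Uniform sets and the splitting of their nodes\<close>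

definition branch_closed :: "'a set \<Rightarrow> bool" where
  "branch_closed U \<longleftrightarrow> (\<forall>x\<in>M. (\<forall>n. U \<inter> N n x \<noteq> {}) \<longrightarrow> x \<in> U)"

text \<open>By monotonicity the cardinal inequality is an equality. The last condition excludes
  isolated points in the topology with the pieces as base, the one in which
  \<open>branch_closed\<close> means closed. It does not follow from the inequality if
  \<open>nodes U\<close> is countable, since one point already has infinitely many nodes.\<close>

definition uniform :: "'a set \<Rightarrow> bool" where
  "uniform U \<longleftrightarrow> U \<subseteq> M \<and> U \<noteq> {} \<and> branch_closed U \<and>
     (\<forall>x\<in>U. \<forall>n. |nodes U| \<le>o |nodes (U \<inter> N n x)| \<and> U \<inter> N n x \<noteq> {x})"

text \<open>The pieces of level \<open>q\<close> map onto those of level \<open>p\<close>, each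
  going to the piece that contains it.\<close>

lemma card_level_mono:
  assumes "W \<subseteq> M" "p \<le> q"
  shows "|N p ` W| \<le>o |N q ` W|"
proof -
  have "N p ` W = (\<lambda>B. N p (SOME z. z \<in> B)) ` (N q ` W)"
  proof -
    have "N p (SOME z. z \<in> N q y) = N p y" if "y \<in> W" for y
    proof -
      have y: "y \<in> M" using that assms by auto
      have "(SOME z. z \<in> N q y) \<in> N q y" using N_self[OF y] by (rule someI)
      then show ?thesis using N_mono[OF y assms(2)] N_eq[OF y] by blast
    qed
    then show ?thesis by (force simp: image_image)
  qed
  then show ?thesis using card_of_image by metis
qed

lemma card_nodes_le:
  assumes "infinite K" "\<And>q. |N q ` W| \<le>o |K|"
  shows "|nodes W| \<le>o |K|"
  unfolding nodes_def
proof (rule card_of_UNION_ordLeq_infinite[OF assms(1)])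
  show "|UNIV :: nat set| \<le>o |K|" using assms(1) infinite_iff_card_of_nat by blast
  show "\<forall>q\<in>UNIV. |{q} \<times> N q ` W| \<le>o |K|"
  proof
    fix q
    have "{q} \<times> N q ` W = Pair q ` (N q ` W)" by auto
    then have "|{q} \<times> N q ` W| \<le>o |N q ` W|" using card_of_image by metis
    then show "|{q} \<times> N q ` W| \<le>o |K|" using assms(2) ordLeq_transitive by blast
  qed
qed

text \<open>If every level of \<open>U \<inter> N p x\<close> had at most \<open>|K|\<close> pieces,
  so would their countable union, for infinite \<open>K\<close>, and uniformity would give
  \<open>|nodes U| \<le>o |K|\<close>. The point \<open>y\<close> shows that some point of
  \<open>U\<close> has left the branch of \<open>x\<close> by level \<open>q\<close>.\<close>

lemma uniform_level_ex:
  assumes U: "uniform U" and x: "x \<in> U" and K: "|K| <o |nodes U|"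
  shows "\<exists>q>p. (infinite K \<longrightarrow> |K| \<le>o |N q ` (U \<inter> N p x)| ) \<and> (\<exists>y\<in>U \<inter> N p x. y \<notin> N q x)"
proof -
  have UM: "U \<subseteq> M" and xM: "x \<in> M" using U x by (auto simp: uniform_def)
  define W where "W = U \<inter> N p x"
  have W: "W \<subseteq> M" "x \<in> W" "W \<noteq> {x}" "|nodes U| \<le>o |nodes W|"
    using U x xM UM N_self[of x p] by (auto simp: uniform_def W_def)
  obtain y where y: "y \<in> W" "y \<noteq> x" using W by blast
  obtain q1 where q1: "y \<notin> N q1 x" using N_sep[OF xM] y by blast
  have "\<exists>q. infinite K \<longrightarrow> |K| \<le>o |N q ` W|"
  proof (rule ccontr)
    assume "\<not> ?thesis"
    then have inf: "infinite K" and "\<And>q. \<not> |K| \<le>o |N q ` W|" by auto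
    then have "|N q ` W| \<le>o |K|" for q
      using ordLeq_total[OF card_of_Well_order card_of_Well_order] by blast
    then have "|nodes W| \<le>o |K|" using card_nodes_le[OF inf] by blast
    then have "|nodes U| \<le>o |K|" using W(4) ordLeq_transitive by blast
    then show False using K not_ordLess_ordLeq by blast
  qed
  then obtain q2 where q2: "infinite K \<longrightarrow> |K| \<le>o |N q2 ` W|" by blast
  define q where "q = Max {q1, q2, Suc p}"
  have q: "q1 \<le> q" "q2 \<le> q" "p < q" by (auto simp: q_def)
  have "infinite K \<longrightarrow> |K| \<le>o |N q ` W|"
    using q2 card_level_mono[OF W(1) q(2)] ordLeq_transitive by blast
  moreover have "y \<notin> N q x" using q1 N_mono[OF xM q(1)] by blast
  ultimately show ?thesis using y(1) q(3) unfolding W_def by blast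
qed

text \<open>Let kappa be \<open>|nodes U|\<close>. A level deeper than \<open>n\<close> with kappa
  pieces serves as \<open>Q\<close> and covers \<open>x\<close> as well. If there is none, the nodes
  that leave the branch of \<open>x\<close> are collected; every point other than \<open>x\<close>
  leaves this branch at some level.\<close>

lemma uniform_split:
  assumes U: "uniform U" and x: "x \<in> U"
  shows "\<exists>Q. Q \<subseteq> nodes (U \<inter> N n x) \<and> (\<forall>s\<in>Q. n < fst s) \<and>
     (\<forall>s\<in>Q. \<forall>t\<in>Q. snd s \<inter> snd t \<noteq> {} \<longrightarrow> s = t) \<and>
     |Q| =o |nodes U| \<and> U \<inter> N n x - \<Union> (snd ` Q) \<subseteq> {x}"
proof -
  have UM: "U \<subseteq> M" and xM: "x \<in> M" using U x by (auto simp: uniform_def)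
  define V where "V = U \<inter> N n x"
  have V: "V \<subseteq> M" "x \<in> V" "|nodes U| \<le>o |nodes V|" "V \<subseteq> U"
    using U x xM UM N_self[of x n] by (auto simp: uniform_def V_def)
  have card_Q: "|Q| =o |nodes U|" if "Q \<subseteq> nodes V" "|nodes U| \<le>o |Q|" for Q
    using that card_of_mono1[of Q "nodes U"] nodes_mono[OF V(4)] by (auto simp: ordIso_iff_ordLeq)
  show ?thesis
  proof (cases "\<exists>m>n. |nodes U| \<le>o |N m ` V|")
    case True
    then obtain m where m: "n < m" "|nodes U| \<le>o |N m ` V|" by blast
    define Q where "Q = {m} \<times> N m ` V"
    have sQ: "snd ` Q = N m ` V" by (auto simp: Q_def)
    have "|N m ` V| \<le>o |Q|" using card_of_image[of snd Q] unfolding sQ .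
    then have a: "|Q| =o |nodes U|"
      using m(2) ordLeq_transitive by (intro card_Q) (auto simp: Q_def nodes_def)
    have b: "Q \<subseteq> nodes (U \<inter> N n x)" by (auto simp: Q_def nodes_def V_def)
    have c: "\<forall>s\<in>Q. n < fst s" using m by (auto simp: Q_def)
    have e: "s = t" if st: "s \<in> Q" "t \<in> Q" "snd s \<inter> snd t \<noteq> {}" for s t
    proof -
      obtain y z where "y \<in> V" "z \<in> V" "s = (m, N m y)" "t = (m, N m z)" using st by (auto simp: Q_def)
      then show ?thesis using st(3) N_eq'[of y z m] V(1) by auto
    qed
    have "V \<subseteq> \<Union> (snd ` Q)" unfolding sQ using N_self V(1) by blast
    then have "U \<inter> N n x - \<Union> (snd ` Q) \<subseteq> {x}" unfolding V_def by blast
    then show ?thesis using a b c e by (intro exI[of _ Q] conjI) blast+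
  next
    case False
    have small: "|N m ` V| <o |nodes U|" for m
    proof (cases "n < m")
      case True
      with False have "\<not> |nodes U| \<le>o |N m ` V|" by blast
      then show ?thesis using not_ordLeq_iff_ordLess[OF card_of_Well_order card_of_Well_order] by blast
    next
      case m: False
      have "N m ` V \<subseteq> {N m x}"
        using N_eq[OF xM] N_mono[OF xM, of m n] m by (auto simp: V_def)
      then have "finite (N m ` V)" using finite_subset by blast
      then show ?thesis using infinite_nodes[OF x] by (rule card_of_finite_ordLess_infinite)
    qed
    \<comment> \<open>Every level is smaller than \<open>nodes U\<close> (cofinality \<open>\<omega>\<close>): collect the nodes branching off \<open>x\<close> at
      levels \<open>P j\<close> chosen so sparsely that the \<open>j\<close>-th batch is at least as large as level \<open>j\<close>.\<close>
    have "\<forall>j p. \<exists>q. q > p \<and> (infinite (N j ` V) \<longrightarrow> |N j ` V| \<le>o |N q ` (U \<inter> N p x)| ) \<and>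
             (\<exists>y\<in>U \<inter> N p x. y \<notin> N q x)"
      using uniform_level_ex[OF U x small] by blast
    then obtain g where g: "\<And>j p. g j p > p"
       "\<And>j p. infinite (N j ` V) \<Longrightarrow> |N j ` V| \<le>o |N (g j p) ` (U \<inter> N p x)|"
       "\<And>j p. \<exists>y\<in>U \<inter> N p x. y \<notin> N (g j p) x" by metis
    define P where "P = rec_nat n g"
    have P0: "P 0 = n" and PS: "P (Suc j) = g j (P j)" for j by (simp_all add: P_def)
    have "strict_mono P" unfolding strict_mono_Suc_iff using g(1) PS by simp
    then have P_less: "i < j \<Longrightarrow> P i < P j" and P_ge: "j \<le> P j" for i j
      by (simp_all add: strict_mono_less strict_mono_imp_increasing)
    define R where "R j = {P (Suc j)} \<times> N (P (Suc j)) ` (U \<inter> N (P j) x - N (P (Suc j)) x)" for j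
    define Q where "Q = (\<Union>j. R j)"
    have RE: "\<exists>y. y \<in> U \<and> y \<in> N (P j) x \<and> y \<notin> N (P (Suc j)) x \<and> s = (P (Suc j), N (P (Suc j)) y)"
      if "s \<in> R j" for s j using that by (auto simp: R_def)
    have Rsub: "snd s \<subseteq> N (P j) x - N (P (Suc j)) x" if s: "s \<in> R j" for s j
    proof -
      obtain y where y: "y \<in> U" "y \<in> N (P j) x" "y \<notin> N (P (Suc j)) x" "s = (P (Suc j), N (P (Suc j)) y)"
        using RE[OF s] by blast
      have yM: "y \<in> M" using y UM by blast
      have "N (P (Suc j)) y \<subseteq> N (P j) y" using N_mono[OF yM, of "P j" "P (Suc j)"] P_less[of j "Suc j"] by simp
      moreover have "N (P j) y = N (P j) x" by (rule N_eq[OF xM y(2)])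
      moreover have "N (P (Suc j)) y \<inter> N (P (Suc j)) x = {}"
        using N_eq'[OF yM xM] N_self[OF yM] y(3) by blast
      ultimately show ?thesis using y(4) by auto
    qed
    have Qsub: "Q \<subseteq> nodes V"
    proof
      fix s assume "s \<in> Q"
      then obtain j where "s \<in> R j" by (auto simp: Q_def)
      then obtain y where y: "y \<in> U" "y \<in> N (P j) x" "s = (P (Suc j), N (P (Suc j)) y)"
        using RE by blast
      have "y \<in> N n x" using N_mono[OF xM, of n "P j"] y(2) P_less[of 0 j] P0 by (cases j) auto
      then show "s \<in> nodes V" using y by (auto simp: V_def intro: nodesI)
    qed
    have R_ne: "\<exists>s. s \<in> R j" for j using g(3)[where p = "P j" and j = j] by (auto simp: R_def PS)
    \<comment> \<open>The choice of \<open>g\<close> bounds the batches from below only for infinite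
      levels. Infinity of \<open>Q\<close>, which follows from all batches being nonempty, takes
      care of finite levels.\<close>
    have infQ: "infinite Q"
    proof
      assume "finite Q"
      then have "finite (fst ` Q)" by simp
      moreover have "range (\<lambda>j. P (Suc j)) \<subseteq> fst ` Q"
      proof
        fix k assume "k \<in> range (\<lambda>j. P (Suc j))"
        then obtain j where j: "k = P (Suc j)" by blast
        obtain s where s: "s \<in> R j" using R_ne by blast
        then have "fst s = k" using j by (auto simp: R_def)
        then show "k \<in> fst ` Q" using s by (auto simp: Q_def)
      qed
      ultimately have "finite (range (\<lambda>j. P (Suc j)))" using finite_subset by blast
      moreover have "inj (\<lambda>j. P (Suc j))"
        using \<open>strict_mono P\<close> by (auto simp: inj_def strict_mono_eq)
      ultimately show False using finite_imageD by blast
    qed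
    have lev: "|N j ` V| \<le>o |Q|" for j
    proof (cases "finite (N j ` V)")
      case True
      then show ?thesis by (rule ordLess_imp_ordLeq[OF card_of_finite_ordLess_infinite[OF _ infQ]])
    next
      case False
      let ?c = "N (P (Suc j)) x"
      have "|N j ` V| \<le>o |N (P (Suc j)) ` (U \<inter> N (P j) x)|" using g(2)[OF False] by (simp add: PS)
      \<comment> \<open>Among the pieces of this level that meet \<open>U \<inter> N (P j) x\<close>
        only that of \<open>x\<close> is absent from the batch, and an infinite \<open>Q\<close>
        absorbs one more element.\<close>
      also have "|N (P (Suc j)) ` (U \<inter> N (P j) x)| \<le>o |{?c} \<union> snd ` Q|"
      proof (rule card_of_mono1, rule subsetI)
        fix B assume "B \<in> N (P (Suc j)) ` (U \<inter> N (P j) x)"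
        then obtain y where y: "y \<in> U" "y \<in> N (P j) x" "B = N (P (Suc j)) y" by blast
        show "B \<in> {?c} \<union> snd ` Q"
        proof (cases "y \<in> N (P (Suc j)) x")
          case True
          then show ?thesis using N_eq[OF xM True] y by blast
        next
          case False
          then have "(P (Suc j), B) \<in> Q" using y by (auto simp: Q_def R_def)
          then show ?thesis by (metis UnCI image_eqI snd_conv)
        qed
      qed
      also have "|{?c} \<union> snd ` Q| \<le>o |Q|"
        using infQ ordLess_imp_ordLeq[OF card_of_finite_ordLess_infinite[OF _ infQ, of "{?c}"]]
        by (intro card_of_Un_ordLeq_infinite_Field) (auto simp: Field_card_of card_of_card_order_on card_of_image)
      finally show ?thesis .
    qed
    have "|nodes V| \<le>o |Q|" by (rule card_nodes_le[OF infQ lev])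
    then have "|nodes U| \<le>o |Q|" using V(3) ordLeq_transitive by blast
    then have cQ: "|Q| =o |nodes U|" using card_Q[OF Qsub] by blast
    have fstQ: "\<forall>s\<in>Q. n < fst s"
      using P_less[of 0 "Suc _"] P0 by (auto simp: Q_def R_def)
    have disj: "s = t" if st: "s \<in> Q" "t \<in> Q" "snd s \<inter> snd t \<noteq> {}" for s t
    proof -
      obtain i j where ij: "s \<in> R i" "t \<in> R j" using st(1,2) by (auto simp: Q_def)
      have no: "snd s' \<inter> snd t' = {}" if "s' \<in> R i'" "t' \<in> R j'" "i' < j'" for s' t' i' j'
      proof -
        have "P (Suc i') \<le> P j'" using that(3) P_less[of "Suc i'" j'] by (cases "Suc i' = j'") auto
        then have "N (P j') x \<subseteq> N (P (Suc i')) x" using N_mono[OF xM] by blast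
        then show ?thesis using Rsub[OF that(1)] Rsub[OF that(2)] by blast
      qed
      have "i = j" using no[OF ij] no[OF ij(2,1)] st(3) by (metis Int_commute linorder_neqE_nat)
      then obtain y z where "y \<in> U" "z \<in> U" "s = (P (Suc i), N (P (Suc i)) y)" "t = (P (Suc i), N (P (Suc i)) z)"
        using RE ij by blast
      then show ?thesis using N_eq'[of y z "P (Suc i)"] st(3) UM by auto
    qed
    have cover: "y \<in> \<Union> (snd ` Q)" if y: "y \<in> V" "y \<noteq> x" for y
    proof -
      obtain q where q: "y \<notin> N q x" using N_sep[OF xM] y by blast
      then have ex: "y \<notin> N (P q) x" using N_mono[OF xM P_ge] by blast
      define j where "j = (LEAST j. y \<notin> N (P j) x)"
      have j: "y \<notin> N (P j) x" unfolding j_def using ex by (rule LeastI)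
      have "j \<noteq> 0" using j y(1) P0 by (metis IntD2 V_def)
      then obtain i where i: "j = Suc i" by (cases j) auto
      have "y \<in> N (P i) x" using not_less_Least[of i "\<lambda>j. y \<notin> N (P j) x"] i unfolding j_def by auto
      then have "(P (Suc i), N (P (Suc i)) y) \<in> Q" using j i y(1) by (auto simp: Q_def R_def V_def)
      moreover have "y \<in> N (P (Suc i)) y" using N_self y(1) V(1) by blast
      ultimately show ?thesis by force
    qed
    have "U \<inter> N n x - \<Union> (snd ` Q) \<subseteq> {x}" using cover unfolding V_def by blast
    then show ?thesis using Qsub fstQ disj cQ unfolding V_def by (intro exI[of _ Q] conjI) blast+
  qed
qed


text \<open>The map \<open>l\<close> labels the leftover points: each is determined by its node at level \<open>l x\<close>.\<close>

lemma uniform_cantor_scheme: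
  assumes U: "uniform U"
  obtains H l where
    "\<And>h. h \<in> H \<Longrightarrow> inj h" "\<And>h. h \<in> H \<Longrightarrow> range h \<subseteq> U"
    "\<And>h n b b'. h \<in> H \<Longrightarrow> agree n b b' \<Longrightarrow> h b' \<in> N n (h b)"
    "\<And>h h' b b'. h \<in> H \<Longrightarrow> h' \<in> H \<Longrightarrow> h b = h' b' \<Longrightarrow> h = h'"
    "\<And>x y. x \<in> U - (\<Union>h\<in>H. range h) \<Longrightarrow> y \<in> U - (\<Union>h\<in>H. range h) \<Longrightarrow> l x = l y \<Longrightarrow>
        N (l x) x = N (l x) y \<Longrightarrow> x = (y::'a)"
proof -
  have UM: "U \<subseteq> M" and Une: "U \<noteq> {}" and Ucl: "branch_closed U" using U by (auto simp: uniform_def)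
  \<comment> \<open>The exceptional point of a split is made a function of the piece alone, so that
    a leftover point can be recovered from one of its nodes.\<close>
  define rep where "rep A = (SOME x. x \<in> U \<and> x \<in> A)" for A
  have rep: "rep (N n x) \<in> U" "N n (rep (N n x)) = N n x" if "x \<in> U" for n x
  proof -
    have "rep (N n x) \<in> U \<and> rep (N n x) \<in> N n x"
      unfolding rep_def by (rule someI[of _ x]) (use that N_self UM in auto)
    then show "rep (N n x) \<in> U" "N n (rep (N n x)) = N n x"
      using N_eq[of x _ n] UM that by auto
  qed
  have "\<forall>s\<in>nodes U. \<exists>Q. Q \<subseteq> nodes (U \<inter> snd s) \<and> (\<forall>t\<in>Q. fst s < fst t) \<and>
     (\<forall>t\<in>Q. \<forall>t'\<in>Q. snd t \<inter> snd t' \<noteq> {} \<longrightarrow> t = t') \<and>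
     |Q| =o |nodes U| \<and> U \<inter> snd s - \<Union> (snd ` Q) \<subseteq> {rep (snd s)}"
  proof
    fix s assume "s \<in> nodes U"
    then obtain n x where x: "x \<in> U" "s = (n, N n x)" by (rule nodesE)
    show "\<exists>Q. Q \<subseteq> nodes (U \<inter> snd s) \<and> (\<forall>t\<in>Q. fst s < fst t) \<and>
     (\<forall>t\<in>Q. \<forall>t'\<in>Q. snd t \<inter> snd t' \<noteq> {} \<longrightarrow> t = t') \<and>
     |Q| =o |nodes U| \<and> U \<inter> snd s - \<Union> (snd ` Q) \<subseteq> {rep (snd s)}"
      using uniform_split[OF U rep(1)[OF x(1)], of n n] rep(2)[OF x(1), of n] x(2) by simp
  qed
  from bchoice[OF this] obtain Q where QQ: "\<forall>s\<in>nodes U. Q s \<subseteq> nodes (U \<inter> snd s) \<and> (\<forall>t\<in>Q s. fst s < fst t) \<and>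
     (\<forall>t\<in>Q s. \<forall>t'\<in>Q s. snd t \<inter> snd t' \<noteq> {} \<longrightarrow> t = t') \<and>
     |Q s| =o |nodes U| \<and> U \<inter> snd s - \<Union> (snd ` Q s) \<subseteq> {rep (snd s)}" ..
  then have Q: "\<And>s. s \<in> nodes U \<Longrightarrow> Q s \<subseteq> nodes (U \<inter> snd s)"
      "\<And>s t. s \<in> nodes U \<Longrightarrow> t \<in> Q s \<Longrightarrow> fst s < fst t"
      "\<And>s t t'. s \<in> nodes U \<Longrightarrow> t \<in> Q s \<Longrightarrow> t' \<in> Q s \<Longrightarrow> snd t \<inter> snd t' \<noteq> {} \<Longrightarrow> t = t'"
      "\<And>s. s \<in> nodes U \<Longrightarrow> |Q s| =o |nodes U|"
      "\<And>s. s \<in> nodes U \<Longrightarrow> U \<inter> snd s - \<Union> (snd ` Q s) \<subseteq> {rep (snd s)}"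
    by simp_all
  have Qnodes: "t \<in> nodes U" if "s \<in> nodes U" "t \<in> Q s" for s t
    using Q(1)[OF that(1)] that(2) nodes_mono[of "U \<inter> snd s" U] by blast
  have Qsub: "snd t \<subseteq> snd s" if st: "s \<in> nodes U" "t \<in> Q s" for s t
  proof -
    obtain m y where y: "y \<in> U \<inter> snd s" "t = (m, N m y)" using Q(1)[OF st(1)] st(2) by (blast elim: nodesE)
    obtain n x where x: "x \<in> U" "s = (n, N n x)" using st(1) by (rule nodesE)
    have "n < m" using Q(2)[OF st] x y by simp
    then have "N m y \<subseteq> N n y" using N_mono[of y n m] UM y by auto
    moreover have "N n y = N n x" using N_eq[of x y n] UM x y by auto
    ultimately show ?thesis using x y by simp
  qed
  \<comment> \<open>Uniformity pays off here: the same index set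
    \<open>nodes U \<times> UNIV\<close> labels the children of every node.\<close>
  have "\<forall>s\<in>nodes U. \<exists>f. bij_betw f (nodes U \<times> (UNIV :: bool set)) (Q s)"
  proof
    fix s assume s: "s \<in> nodes U"
    have inf: "infinite (nodes U)" using Une infinite_nodes by blast
    have "|nodes U \<times> (UNIV :: bool set)| =o |nodes U|"
      using card_of_Times_infinite[OF inf _ ordLess_imp_ordLeq[OF card_of_finite_ordLess_infinite[OF _ inf, of "UNIV :: bool set"]]]
      by simp
    then have "|nodes U \<times> (UNIV :: bool set)| =o |Q s|"
      using Q(4)[OF s] ordIso_symmetric ordIso_transitive by blast
    then show "\<exists>f. bij_betw f (nodes U \<times> (UNIV :: bool set)) (Q s)" by (simp add: card_of_ordIso)
  qed
  from bchoice[OF this] obtain \<phi> where "\<forall>s\<in>nodes U. bij_betw (\<phi> s) (nodes U \<times> (UNIV :: bool set)) (Q s)" ..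
  then have \<phi>: "\<And>s. s \<in> nodes U \<Longrightarrow> bij_betw (\<phi> s) (nodes U \<times> (UNIV :: bool set)) (Q s)"
    by simp
  \<comment> \<open>The sequence \<open>z\<close> of kappa-coordinates selects the Cantor set, and
    the bits \<open>b\<close> select the point in it.\<close>
  define path where "path z b = rec_nat (0, M) (\<lambda>i s. \<phi> s (z i, b i))" for z :: "nat \<Rightarrow> nat \<times> 'a set" and b
  have path0: "path z b 0 = (0, M)" and pathS: "path z b (Suc i) = \<phi> (path z b i) (z i, b i)" for z b i
    by (simp_all add: path_def)
  define Z where "Z = {z :: nat \<Rightarrow> nat \<times> 'a set. range z \<subseteq> nodes U}"
  have root: "(0, M) \<in> nodes U" using Une N_0 UM nodesI[of _ U 0] by (metis ex_in_conv subsetD)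
  have path_Q: "path z b (Suc i) \<in> Q (path z b i)" if "z \<in> Z" "path z b i \<in> nodes U" for z b i
    unfolding pathS using bij_betwE[OF \<phi>[OF that(2)]] that(1) by (auto simp: Z_def)
  have path_nodes: "path z b i \<in> nodes U" if "z \<in> Z" for z b i
    by (induction i) (use root path0 Qnodes path_Q[OF that] in auto)
  note path_Q = path_Q[OF _ path_nodes]
  have path_fst: "i \<le> fst (path z b i)" if "z \<in> Z" for z b i
  proof (induction i)
    case (Suc i)
    then show ?case using Q(2)[OF path_nodes[OF that] path_Q[OF that that]] by (meson Suc_leI le_less_trans)
  qed simp
  have path_anti: "snd (path z b j) \<subseteq> snd (path z b i)" if "z \<in> Z" "i \<le> j" for z b i j
    using that(2) by (induction j rule: dec_induct) (use Qsub[OF path_nodes[OF that(1)] path_Q[OF that(1) that(1)]] in blast)+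
  \<comment> \<open>Points \<open>t i\<close> of \<open>U\<close> chosen in the nodes of the branch
    satisfy the hypothesis of \<open>N_complete\<close>, because the \<open>i\<close>-th node has
    level at least \<open>i\<close>. Their limit lies in \<open>U\<close> since \<open>U\<close> is
    \<open>branch_closed\<close>.\<close>
  have ex: "\<exists>x\<in>U. \<forall>i. x \<in> snd (path z b i)" if z: "z \<in> Z" for z b
  proof -
    have "\<forall>i. \<exists>t. t \<in> U \<and> path z b i = (fst (path z b i), N (fst (path z b i)) t)"
      using path_nodes[OF z, of b] by (metis fst_conv nodesE)
    then obtain t where t: "\<And>i. t i \<in> U" "\<And>i. snd (path z b i) = N (fst (path z b i)) (t i)"
      by (metis snd_conv)
    have tM: "t i \<in> M" for i using t(1) UM by blast
    have tin: "t j \<in> N i (t i)" if "i \<le> j" for i j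
    proof -
      have "t j \<in> snd (path z b j)" using t(2) N_self[OF tM] by simp
      then have "t j \<in> snd (path z b i)" using path_anti[OF z that] by blast
      then show ?thesis using t(2)[of i] N_mono[OF tM[of i], of i "fst (path z b i)"] path_fst[OF z] by auto
    qed
    obtain x where x: "x \<in> M" "\<And>n. t n \<in> N n x" using N_complete[of t] tM tin by (meson le_Suc_eq order_refl)
    have "x \<in> U" using Ucl x t(1) unfolding branch_closed_def by blast
    moreover have "x \<in> snd (path z b i)" for i
    proof -
      define m where "m = fst (path z b i)"
      define n where "n = max m i"
      have "t n \<in> snd (path z b n)" using t(2) N_self[OF tM] by simp
      then have "t n \<in> snd (path z b i)" using path_anti[OF z, of i n] by (auto simp: n_def)
      then have "t n \<in> N m (t i)" using t(2)[of i] by (simp add: m_def)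
      moreover have "t n \<in> N m x" using x(2)[of n] N_mono[OF x(1), of m n] by (auto simp: n_def)
      ultimately have "N m (t i) = N m x" using N_eq' [OF tM x(1)] by blast
      then show ?thesis using t(2)[of i] N_self[OF x(1)] by (simp add: m_def)
    qed
    ultimately show ?thesis by blast
  qed
  define h where "h z b = (SOME x. x \<in> U \<and> (\<forall>i. x \<in> snd (path z b i)))" for z b
  have h: "h z b \<in> U" "h z b \<in> snd (path z b i)" if "z \<in> Z" for z b i
  proof -
    have "\<exists>x. x \<in> U \<and> (\<forall>i. x \<in> snd (path z b i))" using ex[OF that, of b] by blast
    from someI_ex[OF this] show "h z b \<in> U" "h z b \<in> snd (path z b i)" by (auto simp: h_def)
  qed
  have pathN: "snd (path z b i) \<subseteq> N i x" if z: "z \<in> Z" and x: "x \<in> snd (path z b i)" for z b i x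
  proof -
    obtain n y where y: "y \<in> U" "path z b i = (n, N n y)" using path_nodes[OF z] by (rule nodesE)
    have "N n y = N n x" using N_eq[of y x n] y x UM by auto
    moreover have "x \<in> M" using N_sub[of y n] y x UM by auto
    ultimately show ?thesis using N_mono[of x i n] path_fst[OF z, where i = i and b = b] y by simp
  qed
  have h_agree: "h z b' \<in> N n (h z b)" if z: "z \<in> Z" and a: "agree n b b'" for z b b' n
  proof -
    have "path z b' i = path z b i" if "i \<le> n" for i
      using that a by (induction i) (auto simp: path0 pathS agree_def)
    then have "h z b' \<in> snd (path z b n)" using h(2)[OF z, of b' n] by simp
    then show ?thesis using pathN[OF z h(2)[OF z]] by blast
  qed
  \<comment> \<open>At the first index where \<open>(z, b)\<close> and \<open>(z', b')\<close>
    differ, the two paths move from a common node to distinct, hence disjoint, children.\<close>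
  have h_inj: "z = z' \<and> b = b'" if z: "z \<in> Z" "z' \<in> Z" and e: "h z b = h z' b'" for z z' b b'
  proof (rule ccontr)
    assume "\<not> (z = z' \<and> b = b')"
    then have ne: "\<exists>i. (z i, b i) \<noteq> (z' i, b' i)" by auto
    define i where "i = (LEAST i. (z i, b i) \<noteq> (z' i, b' i))"
    have i: "(z i, b i) \<noteq> (z' i, b' i)" unfolding i_def using ne by (rule LeastI_ex)
    have lt: "(z j, b j) = (z' j, b' j)" if "j < i" for j
      using not_less_Least[of j "\<lambda>i. (z i, b i) \<noteq> (z' i, b' i)"] that unfolding i_def by blast
    have "path z b j = path z' b' j" if "j \<le> i" for j
      using that by (induction j) (use lt in \<open>auto simp: path0 pathS\<close>)
    then have pi: "path z' b' i = path z b i" by simp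
    have "path z b (Suc i) = path z' b' (Suc i)"
    proof (rule Q(3)[OF path_nodes[OF z(1), of b i] path_Q[OF z(1) z(1)]])
      show "path z' b' (Suc i) \<in> Q (path z b i)" using path_Q[OF z(2) z(2), of b' i] pi by simp
      show "snd (path z b (Suc i)) \<inter> snd (path z' b' (Suc i)) \<noteq> {}"
        using h(2)[OF z(1), of b "Suc i"] h(2)[OF z(2), of b' "Suc i"] e by auto
    qed
    then have "\<phi> (path z b i) (z i, b i) = \<phi> (path z b i) (z' i, b' i)" by (simp add: pathS pi)
    moreover have "inj_on (\<phi> (path z b i)) (nodes U \<times> UNIV)"
      using \<phi>[OF path_nodes[OF z(1)]] by (rule bij_betw_imp_inj_on)
    moreover have "(z i, b i) \<in> nodes U \<times> UNIV" "(z' i, b' i) \<in> nodes U \<times> UNIV" using z by (auto simp: Z_def)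
    ultimately show False using i by (metis inj_onD)
  qed
  \<comment> \<open>A point that is the exceptional point of none of its nodes always lies in some
    child. Following these children from the root yields \<open>z\<close> and \<open>b\<close> with
    \<open>x = h z b\<close>.\<close>
  have exc: "\<exists>s\<in>nodes U. x \<in> snd s \<and> x = rep (snd s)" if x: "x \<in> U" "x \<notin> (\<Union>z\<in>Z. range (h z))" for x
  proof (rule ccontr)
    assume no: "\<not> ?thesis"
    have step: "\<exists>c. c \<in> nodes U \<times> UNIV \<and> x \<in> snd (\<phi> s c)" if s: "s \<in> nodes U" "x \<in> snd s" for s
    proof -
      have "x \<in> \<Union> (snd ` Q s)" using Q(5)[OF s(1)] no s x by blast
      then obtain t where t: "t \<in> Q s" "x \<in> snd t" by blast
      have "t \<in> \<phi> s ` (nodes U \<times> UNIV)" using t(1) bij_betw_imp_surj_on[OF \<phi>[OF s(1)]] by simp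
      then obtain c where "t = \<phi> s c" "c \<in> nodes U \<times> UNIV" by (rule imageE)
      then show ?thesis using t(2) by blast
    qed
    define c where "c s = (SOME c. c \<in> nodes U \<times> UNIV \<and> x \<in> snd (\<phi> s c))" for s
    have c: "c s \<in> nodes U \<times> UNIV" "x \<in> snd (\<phi> s (c s))" if "s \<in> nodes U" "x \<in> snd s" for s
      using someI_ex[OF step[OF that]] by (auto simp: c_def)
    define t where "t = rec_nat (0, M) (\<lambda>i s. \<phi> s (c s))"
    have t0: "t 0 = (0, M)" and tS: "t (Suc i) = \<phi> (t i) (c (t i))" for i by (simp_all add: t_def)
    have t: "t i \<in> nodes U \<and> x \<in> snd (t i)" for i
    proof (induction i)
      case 0
      then show ?case using root x UM by (auto simp: t0)
    next
      case (Suc i)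
      then have "t (Suc i) \<in> Q (t i)" unfolding tS using c bij_betwE[OF \<phi>] by blast
      then show ?case using Suc Qnodes c unfolding tS by blast
    qed
    define z where "z i = fst (c (t i))" for i
    define b where "b i = snd (c (t i))" for i
    have "z i \<in> nodes U" for i using c(1)[of "t i"] t[of i] by (auto simp: z_def mem_Times_iff)
    then have z: "z \<in> Z" by (auto simp: Z_def)
    have "path z b i = t i" for i by (induction i) (auto simp: path0 pathS t0 tS z_def b_def)
    then have xp: "x \<in> snd (path z b i)" for i using t by simp
    have "x = h z b"
    proof (rule N_sep)
      show "h z b \<in> M" using h(1)[OF z] UM by blast
      show "x \<in> N n (h z b)" for n using pathN[OF z h(2)[OF z]] xp by blast
    qed
    then show False using x(2) z by blast
  qed
  define l where "l x = (SOME n. \<exists>A. (n, A) \<in> nodes U \<and> x \<in> A \<and> x = rep A)" for x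
  have l: "rep (N (l x) x) = x" if x: "x \<in> U" "x \<notin> (\<Union>h\<in>h ` Z. range h)" for x
  proof -
    have "\<exists>n A. (n, A) \<in> nodes U \<and> x \<in> A \<and> x = rep A" using exc[of x] x by fastforce
    from someI_ex[OF this] obtain A where A: "(l x, A) \<in> nodes U" "x \<in> A" "x = rep A" by (auto simp: l_def)
    then obtain y where "y \<in> U" "A = N (l x) y" by (auto elim: nodesE)
    then show ?thesis using N_eq[of y x "l x"] A UM by auto
  qed
  show ?thesis
  proof (rule that[of "h ` Z" l])
    show "inj k" if "k \<in> h ` Z" for k using that h_inj by (auto simp: inj_def)
    show "range k \<subseteq> U" if "k \<in> h ` Z" for k using that h(1) by auto
    show "k b' \<in> N n (k b)" if "k \<in> h ` Z" "agree n b b'" for k n b b' using that h_agree by auto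
    show "k = k'" if "k \<in> h ` Z" "k' \<in> h ` Z" "k b = k' b'" for k k' b b' using that h_inj by blast
    show "x = y" if "x \<in> U - (\<Union>h\<in>h ` Z. range h)" "y \<in> U - (\<Union>h\<in>h ` Z. range h)"
        "l x = l y" "N (l x) x = N (l x) y" for x y
      using l[of x] l[of y] that by (metis DiffD1 DiffD2)
  qed
qed


text \<open>A member \<open>(s, U)\<close> of a peeling is a set \<open>U\<close> tagged with a node \<open>s\<close> from which \<open>U\<close> is what the
  earlier members left; tags are distinct, so a leftover point is determined by two nodes.\<close>

definition peeling :: "((nat \<times> 'a set) \<times> 'a set) set \<Rightarrow> bool" where
  "peeling W \<longleftrightarrow>
     (\<forall>p\<in>W. fst p \<in> nodes M \<and> snd p \<subseteq> snd (fst p) \<and> (uniform (snd p) \<or> (\<exists>x\<in>M. snd p = {x})) \<and>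
        snd (fst p) \<subseteq> \<Union> (snd ` W)) \<and>
     (\<forall>p\<in>W. \<forall>q\<in>W. p \<noteq> q \<longrightarrow> fst p \<noteq> fst q \<and> snd p \<inter> snd q = {})"

text \<open>If no piece isolates a point of \<open>Y\<close>, take a piece with the fewest nodes of
  \<open>Y\<close> below it. Minimality gives the cardinal condition of \<open>uniform\<close>, and
  the absence of isolated points gives the other.\<close>

lemma peeling_step:
  assumes Y: "branch_closed Y" "Y \<subseteq> M" "Y \<noteq> {}"
  shows "\<exists>x n. x \<in> Y \<and> (uniform (Y \<inter> N n x) \<or> Y \<inter> N n x = {x})"
proof (cases "\<exists>x\<in>Y. \<exists>n. Y \<inter> N n x = {x}")
  case True
  then show ?thesis by blast
next
  case False
  define R where "R = (\<lambda>(n, x). |nodes (Y \<inter> N n x)| ) ` (UNIV \<times> Y)"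
  have "R \<noteq> {}" using Y by (auto simp: R_def)
  moreover have "\<forall>r\<in>R. Card_order r" by (auto simp: R_def card_of_Card_order)
  ultimately obtain r where r: "r \<in> R" "\<forall>r'\<in>R. r \<le>o r'" using exists_minim_Card_order by blast
  then obtain n x where x: "x \<in> Y" "r = |nodes (Y \<inter> N n x)|" by (auto simp: R_def)
  have xM: "x \<in> M" using x Y by blast
  have min: "|nodes (Y \<inter> N n x)| \<le>o |nodes (Y \<inter> N m y)|" if "y \<in> Y" for m y
    using r(2) that unfolding x(2) by (auto simp: R_def)
  have "uniform (Y \<inter> N n x)"
    unfolding uniform_def
  proof (intro conjI ballI allI)
    show "Y \<inter> N n x \<subseteq> M" using Y by blast
    show "Y \<inter> N n x \<noteq> {}" using x N_self[OF xM] by blast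
    show "branch_closed (Y \<inter> N n x)"
      unfolding branch_closed_def
    proof (intro ballI impI)
      fix y assume y: "y \<in> M" "\<forall>m. Y \<inter> N n x \<inter> N m y \<noteq> {}"
      have "y \<in> Y" using Y(1) y unfolding branch_closed_def by blast
      moreover have "N n x = N n y" using y N_eq'[OF xM y(1), of n] by blast
      ultimately show "y \<in> Y \<inter> N n x" using N_self[OF y(1)] by blast
    qed
    fix y m assume y: "y \<in> Y \<inter> N n x"
    then have yM: "y \<in> M" using Y by blast
    \<comment> \<open>Two pieces around \<open>y\<close> meet in the deeper one, which is again a
      competitor for the minimum.\<close>
    have eq: "Y \<inter> N n x \<inter> N m y = Y \<inter> N (max n m) y"
    proof -
      have "N n x = N n y" using N_eq[OF xM, of y n] y by simp
      moreover have "N n y \<inter> N m y = N (max n m) y"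
        using N_mono[OF yM, of n m] N_mono[OF yM, of m n] by (cases "n \<le> m") (auto simp: max_def)
      ultimately show ?thesis by blast
    qed
    show "|nodes (Y \<inter> N n x)| \<le>o |nodes (Y \<inter> N n x \<inter> N m y)|" unfolding eq using min y by blast
    show "Y \<inter> N n x \<inter> N m y \<noteq> {y}" unfolding eq using False y by blast
  qed
  then show ?thesis using x by blast
qed

text \<open>Since the tags of a peeling are covered by its members, the covered set is a union of
  whole pieces and the rest \<open>Y\<close> is \<open>branch_closed\<close>. So
  \<open>peeling_step\<close> would extend a maximal peeling with \<open>Y \<noteq> {}\<close>. The
  new tag contains an uncovered point and hence differs from all earlier ones.\<close>

lemma peeling_ex: "\<exists>W. peeling W \<and> \<Union> (snd ` W) = M"
proof -
  have "\<forall>C\<in>chains (Collect peeling). \<Union>C \<in> Collect peeling"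
  proof
    fix C assume C: "C \<in> chains (Collect peeling)"
    have sub: "\<And>W. W \<in> C \<Longrightarrow> peeling W" using C by (auto simp: chains_def)
    have "peeling (\<Union>C)"
      unfolding peeling_def
    proof (rule conjI)
      show "\<forall>p\<in>\<Union>C. fst p \<in> nodes M \<and> snd p \<subseteq> snd (fst p) \<and> (uniform (snd p) \<or> (\<exists>x\<in>M. snd p = {x})) \<and>
        snd (fst p) \<subseteq> \<Union> (snd ` \<Union>C)"
      proof
        fix p assume "p \<in> \<Union>C"
        then obtain W where W: "W \<in> C" "p \<in> W" by blast
        then have "\<Union> (snd ` W) \<subseteq> \<Union> (snd ` \<Union>C)" by blast
        then show "fst p \<in> nodes M \<and> snd p \<subseteq> snd (fst p) \<and> (uniform (snd p) \<or> (\<exists>x\<in>M. snd p = {x})) \<and>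
          snd (fst p) \<subseteq> \<Union> (snd ` \<Union>C)"
          using sub[OF W(1)] W(2) unfolding peeling_def by (meson subset_trans)
      qed
      show "\<forall>p\<in>\<Union>C. \<forall>q\<in>\<Union>C. p \<noteq> q \<longrightarrow> fst p \<noteq> fst q \<and> snd p \<inter> snd q = {}"
      proof (intro ballI impI)
        fix p q assume pq: "p \<in> \<Union>C" "q \<in> \<Union>C" "p \<noteq> q"
        then obtain W W' where W: "W \<in> C" "p \<in> W" "W' \<in> C" "q \<in> W'" by blast
        then have "W \<subseteq> W' \<or> W' \<subseteq> W" using C by (auto simp: chains_def chain_subset_def)
        then obtain W'' where "W'' \<in> C" "p \<in> W''" "q \<in> W''" using W by blast
        then show "fst p \<noteq> fst q \<and> snd p \<inter> snd q = {}" using sub pq(3) unfolding peeling_def by blast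
      qed
    qed
    then show "\<Union>C \<in> Collect peeling" by simp
  qed
  from Zorn_Lemma[OF this] obtain W where W: "peeling W" and max: "\<And>X. peeling X \<Longrightarrow> W \<subseteq> X \<Longrightarrow> X = W"
    by blast
  have Wnode: "\<And>p. p \<in> W \<Longrightarrow> fst p \<in> nodes M" and Wsub: "\<And>p. p \<in> W \<Longrightarrow> snd p \<subseteq> snd (fst p)"
    and Wcov: "\<And>p. p \<in> W \<Longrightarrow> snd (fst p) \<subseteq> \<Union> (snd ` W)"
    and Wu: "\<And>p. p \<in> W \<Longrightarrow> uniform (snd p) \<or> (\<exists>x\<in>M. snd p = {x})"
    and Wd: "\<And>p q. p \<in> W \<Longrightarrow> q \<in> W \<Longrightarrow> p \<noteq> q \<Longrightarrow> fst p \<noteq> fst q \<and> snd p \<inter> snd q = {}"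
    using W unfolding peeling_def by simp_all
  define Y where "Y = M - \<Union> (snd ` W)"
  have WM: "\<Union> (snd ` W) \<subseteq> M" using Wu by (fastforce simp: uniform_def)
  have "Y = {}"
  proof (rule ccontr)
    assume ne: "Y \<noteq> {}"
    have "branch_closed Y"
      unfolding branch_closed_def
    proof (intro ballI impI, rule ccontr)
      fix x assume x: "x \<in> M" "\<forall>n. Y \<inter> N n x \<noteq> {}" "x \<notin> Y"
      then obtain p where p: "p \<in> W" "x \<in> snd p" by (auto simp: Y_def)
      obtain n y where y: "y \<in> M" "fst p = (n, N n y)" using Wnode[OF p(1)] by (rule nodesE)
      have "N n x = N n y" using N_eq[of y x n] Wsub[OF p(1)] p(2) y by auto
      then have "N n x \<subseteq> \<Union> (snd ` W)" using Wcov[OF p(1)] y by simp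
      then show False using x(2) unfolding Y_def by blast
    qed
    then obtain x n where x: "x \<in> Y" "uniform (Y \<inter> N n x) \<or> Y \<inter> N n x = {x}"
      using peeling_step[of Y] ne by (auto simp: Y_def)
    have xM: "x \<in> M" using x by (simp add: Y_def)
    define p where "p = ((n, N n x), Y \<inter> N n x)"
    have pfst: "fst p = (n, N n x)" and psnd: "snd p = Y \<inter> N n x" by (simp_all add: p_def)
    have cov: "\<Union> (snd ` insert p W) = Y \<inter> N n x \<union> \<Union> (snd ` W)" by (simp add: psnd)
    have new: "fst q \<noteq> fst p \<and> snd q \<inter> snd p = {}" if "q \<in> W" for q
    proof -
      have "x \<notin> snd (fst q)" using Wcov[OF that] x(1) unfolding Y_def by blast
      then have "fst q \<noteq> fst p" unfolding pfst using N_self[OF xM, of n] by auto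
      moreover have "snd q \<subseteq> \<Union> (snd ` W)" using that by blast
      ultimately show ?thesis unfolding psnd Y_def by blast
    qed
    have "peeling (insert p W)"
      unfolding peeling_def cov
    proof (rule conjI)
      show "\<forall>q\<in>insert p W. fst q \<in> nodes M \<and> snd q \<subseteq> snd (fst q) \<and> (uniform (snd q) \<or> (\<exists>x\<in>M. snd q = {x})) \<and>
          snd (fst q) \<subseteq> Y \<inter> N n x \<union> \<Union> (snd ` W)"
      proof (intro ballI conjI)
        fix q assume q: "q \<in> insert p W"
        show "fst q \<in> nodes M" using q Wnode pfst nodesI[OF xM] by (metis insertE)
        show "snd q \<subseteq> snd (fst q)" using q Wsub pfst psnd by (metis Int_lower2 insertE snd_conv)
        show "uniform (snd q) \<or> (\<exists>x\<in>M. snd q = {x})" using q Wu psnd x(2) xM by (metis insertE)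
        have "N n x \<subseteq> Y \<inter> N n x \<union> \<Union> (snd ` W)" using N_sub[OF xM, of n] unfolding Y_def by blast
        then show "snd (fst q) \<subseteq> Y \<inter> N n x \<union> \<Union> (snd ` W)" using q Wcov pfst by (metis insertE snd_conv sup.coboundedI2)
      qed
      show "\<forall>q\<in>insert p W. \<forall>q'\<in>insert p W. q \<noteq> q' \<longrightarrow> fst q \<noteq> fst q' \<and> snd q \<inter> snd q' = {}"
        using Wd new by (metis Int_commute insertE)
    qed
    then have "p \<in> W" using max[of "insert p W"] by blast
    then show False using new by blast
  qed
  then have "\<Union> (snd ` W) = M" using WM unfolding Y_def by blast
  then show ?thesis using W by blast
qed

text \<open>Each member of a peeling is treated separately. For a leftover \<open>x\<close> the node
  \<open>(k x, N (k x) x)\<close> is the tag of its member, and the node of level \<open>l x\<close>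
  then determines \<open>x\<close> within that member.\<close>

lemma cantor_scheme:
  obtains H k l where
    "\<And>h. h \<in> H \<Longrightarrow> inj h" "\<And>h. h \<in> H \<Longrightarrow> range h \<subseteq> M"
    "\<And>h n b b'. h \<in> H \<Longrightarrow> agree n b b' \<Longrightarrow> h b' \<in> N n (h b)"
    "\<And>h h' b b'. h \<in> H \<Longrightarrow> h' \<in> H \<Longrightarrow> h b = h' b' \<Longrightarrow> h = h'"
    "\<And>x y. x \<in> M - (\<Union>h\<in>H. range h) \<Longrightarrow> y \<in> M - (\<Union>h\<in>H. range h) \<Longrightarrow>
        k x = k y \<Longrightarrow> N (k x) x = N (k x) y \<Longrightarrow> l x = l y \<Longrightarrow> N (l x) x = N (l x) y \<Longrightarrow> x = (y::'a)"
proof -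
  obtain W where W: "peeling W" "\<Union> (snd ` W) = M" using peeling_ex by blast
  have Wnode: "\<And>p. p \<in> W \<Longrightarrow> fst p \<in> nodes M" and Wsub: "\<And>p. p \<in> W \<Longrightarrow> snd p \<subseteq> snd (fst p)"
    and Wu: "\<And>p. p \<in> W \<Longrightarrow> uniform (snd p) \<or> (\<exists>x\<in>M. snd p = {x})"
    and Wd: "\<And>p q. p \<in> W \<Longrightarrow> q \<in> W \<Longrightarrow> p \<noteq> q \<Longrightarrow> fst p \<noteq> fst q \<and> snd p \<inter> snd q = {}"
    using W(1) unfolding peeling_def by simp_all
  define good where "good U H l \<longleftrightarrow>
     (\<forall>h\<in>H. inj h) \<and> (\<forall>h\<in>H. range h \<subseteq> U) \<and> (\<forall>h\<in>H. \<forall>n b b'. agree n b b' \<longrightarrow> h b' \<in> N n (h b)) \<and>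
     (\<forall>h\<in>H. \<forall>h'\<in>H. \<forall>b b'. h b = h' b' \<longrightarrow> h = h') \<and>
     (\<forall>x\<in>U - (\<Union>h\<in>H. range h). \<forall>y\<in>U - (\<Union>h\<in>H. range h). l x = l y \<longrightarrow> N (l x) x = N (l x) y \<longrightarrow> x = y)"
    for U :: "'a set" and H :: "((nat \<Rightarrow> bool) \<Rightarrow> 'a) set" and l :: "'a \<Rightarrow> nat"
  have good_ex: "\<exists>H l. good U H l" if U: "uniform U \<or> (\<exists>x\<in>M. U = {x})" for U
  proof (cases "uniform U")
    case True
    then show ?thesis
    proof (rule uniform_cantor_scheme)
      fix H l
      assume a1: "\<And>h. h \<in> H \<Longrightarrow> inj h" and a2: "\<And>h. h \<in> H \<Longrightarrow> range h \<subseteq> U"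
        and a3: "\<And>h n b b'. h \<in> H \<Longrightarrow> agree n b b' \<Longrightarrow> h b' \<in> N n (h b)"
        and a4: "\<And>h h' b b'. h \<in> H \<Longrightarrow> h' \<in> H \<Longrightarrow> h b = h' b' \<Longrightarrow> h = h'"
        and a5: "\<And>x y. x \<in> U - (\<Union>h\<in>H. range h) \<Longrightarrow> y \<in> U - (\<Union>h\<in>H. range h) \<Longrightarrow> l x = l y \<Longrightarrow>
          N (l x) x = N (l x) y \<Longrightarrow> x = y"
      have "good U H l"
        unfolding good_def
        by (intro conjI ballI allI impI) (erule a1, erule a2, erule (1) a3, erule (2) a4, erule (3) a5)
      then show ?thesis by blast
    qed
  next
    case False
    with U obtain x where "U = {x}" by blast
    \<comment> \<open>A singleton contributes no Cantor set: its point is left over and is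
      determined by the tag alone.\<close>
    then show ?thesis unfolding good_def by (intro exI[of _ "{}"]) auto
  qed
  have "\<forall>U. \<exists>H l. uniform U \<or> (\<exists>x\<in>M. U = {x}) \<longrightarrow> good U H l"
  proof
    fix U show "\<exists>H l. uniform U \<or> (\<exists>x\<in>M. U = {x}) \<longrightarrow> good U H l" using good_ex[of U] by meson
  qed
  from choice[OF this] obtain HH where "\<forall>U. \<exists>l. uniform U \<or> (\<exists>x\<in>M. U = {x}) \<longrightarrow> good U (HH U) l" ..
  from choice[OF this] obtain ll where "\<forall>U. uniform U \<or> (\<exists>x\<in>M. U = {x}) \<longrightarrow> good U (HH U) (ll U)" ..
  then have good: "good (snd p) (HH (snd p)) (ll (snd p))" if "p \<in> W" for p using Wu[OF that] by blast
  have inj: "inj h" and ran: "range h \<subseteq> snd p" and agr: "agree n b b' \<Longrightarrow> h b' \<in> N n (h b)"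
    if "p \<in> W" "h \<in> HH (snd p)" for p h n b b'
    using good[OF that(1)] that(2) unfolding good_def by simp_all
  have dis: "h = h'" if "p \<in> W" "h \<in> HH (snd p)" "h' \<in> HH (snd p)" "h b = h' b'" for p h h' b b'
    using good[OF that(1)] that(2-) unfolding good_def by blast
  have exc: "\<forall>x\<in>snd p - (\<Union>h\<in>HH (snd p). range h). \<forall>y\<in>snd p - (\<Union>h\<in>HH (snd p). range h).
      ll (snd p) x = ll (snd p) y \<longrightarrow> N (ll (snd p) x) x = N (ll (snd p) x) y \<longrightarrow> x = y" if "p \<in> W" for p
    using good[OF that] unfolding good_def by (elim conjE)
  define H where "H = (\<Union>p\<in>W. HH (snd p))"
  define pp where "pp x = (SOME p. p \<in> W \<and> x \<in> snd p)" for x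
  have pp: "pp x \<in> W" "x \<in> snd (pp x)" if "x \<in> M" for x
  proof -
    have "\<exists>p. p \<in> W \<and> x \<in> snd p" using that W(2) by blast
    from someI_ex[OF this] show "pp x \<in> W" "x \<in> snd (pp x)" by (auto simp: pp_def)
  qed
  define k where "k x = fst (fst (pp x))" for x
  define l where "l x = ll (snd (pp x)) x" for x
  have fst_pp: "fst (pp x) = (k x, N (k x) x)" if x: "x \<in> M" for x
  proof -
    obtain n y where y: "y \<in> M" "fst (pp x) = (n, N n y)" using Wnode[OF pp(1)[OF x]] by (rule nodesE)
    then have "x \<in> N n y" using Wsub[OF pp(1)[OF x]] pp(2)[OF x] by auto
    then show ?thesis using N_eq[OF y(1)] y(2) by (simp add: k_def)
  qed
  show ?thesis
  proof (rule that[of H k l])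
    have Hp: "\<exists>p\<in>W. h \<in> HH (snd p)" if "h \<in> H" for h using that by (simp add: H_def)
    show "inj h" if "h \<in> H" for h using Hp[OF that] inj by (elim bexE)
    show "range h \<subseteq> M" if h: "h \<in> H" for h
    proof -
      obtain p where "p \<in> W" "h \<in> HH (snd p)" using Hp[OF h] ..
      moreover have "snd p \<subseteq> M" using W(2) \<open>p \<in> W\<close> by blast
      ultimately show ?thesis using ran[of p h] by simp
    qed
    show "h b' \<in> N n (h b)" if h: "h \<in> H" and a: "agree n b b'" for h n b b'
      using Hp[OF h] agr[OF _ _ a] by (elim bexE)
    show "h = h'" if hh: "h \<in> H" "h' \<in> H" "h b = h' b'" for h h' b b'
    proof -
      obtain p p' where p: "p \<in> W" "h \<in> HH (snd p)" "p' \<in> W" "h' \<in> HH (snd p')"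
        using Hp[OF hh(1)] Hp[OF hh(2)] by (elim bexE)
      have "h b \<in> snd p \<inter> snd p'" using ran[OF p(1,2)] ran[OF p(3,4)] hh(3) by (metis IntI rangeI subsetD)
      then have "p = p'" using Wd[OF p(1,3)] by blast
      then show ?thesis using dis[of p h h' b b'] p hh(3) by simp
    qed
    show "x = y" if xy: "x \<in> M - (\<Union>h\<in>H. range h)" "y \<in> M - (\<Union>h\<in>H. range h)"
       "k x = k y" "N (k x) x = N (k x) y" "l x = l y" "N (l x) x = N (l x) y" for x y
    proof -
      have M: "x \<in> M" "y \<in> M" using xy by auto
      have "fst (pp x) = fst (pp y)" using fst_pp M xy(3,4) by simp
      then have pe: "pp y = pp x" using Wd[OF pp(1)[OF M(1)] pp(1)[OF M(2)]] by metis
      have sub: "(\<Union>h\<in>HH (snd (pp x)). range h) \<subseteq> (\<Union>h\<in>H. range h)" using pp(1)[OF M(1)] unfolding H_def by blast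
      have xin: "x \<in> snd (pp x) - (\<Union>h\<in>HH (snd (pp x)). range h)"
        by (rule DiffI[OF pp(2)[OF M(1)]]) (rule notI, drule subsetD[OF sub], erule DiffD2[OF xy(1)])
      have yin: "y \<in> snd (pp x) - (\<Union>h\<in>HH (snd (pp x)). range h)"
        by (rule DiffI[OF pp(2)[OF M(2), unfolded pe]]) (rule notI, drule subsetD[OF sub], erule DiffD2[OF xy(2)])
      have "ll (snd (pp x)) x = ll (snd (pp x)) y" "N (ll (snd (pp x)) x) x = N (ll (snd (pp x)) x) y"
        using xy(5,6) unfolding l_def pe .
      then show ?thesis using exc[OF pp(1)[OF M(1)], THEN bspec, OF xin, THEN bspec, OF yin] by simp
    qed
  qed
qed

end

section \<open>Partitions of complete metric spaces into F-sigma sets\<close>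

context Metric_space
begin

text \<open>A point \<open>w\<close> outside \<open>U\<close> with \<open>d z w < e\<close> still
  lies in \<open>mball y e\<close> for all \<open>y\<close> within \<open>e - d z w\<close> of
  \<open>z\<close>.\<close>

lemma closedin_ball_inside: "closedin mtopology {y \<in> M. mball y e \<subseteq> U}"
proof -
  have "openin mtopology (M - {y \<in> M. mball y e \<subseteq> U})"
    unfolding openin_mtopology
  proof (intro conjI allI impI)
    fix z assume "z \<in> M - {y \<in> M. mball y e \<subseteq> U}"
    then have "z \<in> M" "\<not> mball z e \<subseteq> U" by auto
    then obtain w where w: "z \<in> M" "w \<in> M" "d z w < e" "w \<notin> U" by (meson in_mball subsetI)
    have "mball z (e - d z w) \<subseteq> M - {y \<in> M. mball y e \<subseteq> U}"
    proof
      fix y assume y: "y \<in> mball z (e - d z w)"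
      have "d y w \<le> d z y + d z w" using triangle''[of y z w] y w commute by (metis in_mball)
      then have "w \<in> mball y e" using y w by simp
      then show "y \<in> M - {y \<in> M. mball y e \<subseteq> U}" using y w by auto
    qed
    then show "\<exists>r>0. mball z r \<subseteq> M - {y \<in> M. mball y e \<subseteq> U}"
      using w by (intro exI[of _ "e - d z w"]) auto
  qed auto
  then show ?thesis by (auto simp: closedin_def)
qed

text \<open>The code \<open>c\<close> is that of Stone's proof that metric spaces have \<open>\<sigma>\<close>-discrete bases.\<close>

lemma refining_partitions_ex:
  assumes compl: mcomplete
  obtains N and c :: "nat \<Rightarrow> 'a \<Rightarrow> nat" where
    "refining_partitions M N"
    "\<And>n x y. x \<in> M \<Longrightarrow> y \<in> N (Suc n) x \<Longrightarrow> d x y < 2 / Suc n"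
    "\<And>n v. \<exists>e>0. \<forall>x\<in>M. \<forall>y\<in>M. c n x = v \<longrightarrow> c n y = v \<longrightarrow> N n x \<noteq> N n y \<longrightarrow> e \<le> d x y"
proof -
  obtain r :: "'a rel" where r: "well_order_on UNIV r" using well_order_on by blast
  have wf: "wf (r - Id)" using r by (simp add: well_order_on_def)
  have tot: "(x, y) \<in> r - Id \<or> (y, x) \<in> r - Id" if "x \<noteq> y" for x y
    using r that by (auto simp: well_order_on_def linear_order_on_def total_on_def)
  define B where "B n y = mball y (1 / Suc n)" for n y
  have Bopen: "openin mtopology (B n y)" for n y by (simp add: B_def)
  \<comment> \<open>The least centre, in the well-order \<open>r\<close>, whose ball of radius
    \<open>1 / Suc n\<close> contains \<open>x\<close>.\<close>
  define first where "first n x = (SOME y. x \<in> B n y \<and> (\<forall>y'. (y', y) \<in> r - Id \<longrightarrow> x \<notin> B n y'))" for n x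
  have first: "x \<in> B n (first n x)" "\<And>y'. (y', first n x) \<in> r - Id \<Longrightarrow> x \<notin> B n y'" if "x \<in> M" for n x
  proof -
    have "x \<in> {y. x \<in> B n y}" using that by (simp add: B_def)
    from wfE_min[OF wf this] obtain y where "x \<in> B n y \<and> (\<forall>y'. (y', y) \<in> r - Id \<longrightarrow> x \<notin> B n y')"
      by (metis mem_Collect_eq)
    then have "x \<in> B n (first n x) \<and> (\<forall>y'. (y', first n x) \<in> r - Id \<longrightarrow> x \<notin> B n y')"
      unfolding first_def by (rule someI)
    then show "x \<in> B n (first n x)" "\<And>y'. (y', first n x) \<in> r - Id \<Longrightarrow> x \<notin> B n y'" by blast+
  qed
  have first_eq: "first n x = e \<longleftrightarrow> x \<in> B n e \<and> (\<forall>y'. (y', e) \<in> r - Id \<longrightarrow> x \<notin> B n y')" if "x \<in> M" for n x e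
    using first(1)[OF that, of n] first(2)[OF that, of _ n] tot[of "first n x" e] by metis
  \<comment> \<open>The points lying \<open>1 / Suc j\<close> deep inside the ball
    \<open>B n e\<close>. The least such \<open>j\<close> is the \<open>depth\<close>, which will
    give the lower bound on distances.\<close>
  define C where "C n e j = {y \<in> M. mball y (1 / Suc j) \<subseteq> B n e}" for n e j
  have Cclosed: "closedin mtopology (C n e j)" for n e j unfolding C_def by (rule closedin_ball_inside)
  define depth where "depth n x = (LEAST m. x \<in> C n (first n x) m)" for n x
  have depth: "x \<in> C n (first n x) (depth n x)" if x: "x \<in> M" for n x
  proof -
    obtain e where e: "e > 0" "mball x e \<subseteq> B n (first n x)"
      using Bopen[of n "first n x"] first(1)[OF x, of n] unfolding openin_mtopology by blast
    obtain m where "1 / Suc m < e" using e(1) by (meson nat_approx_posE)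
    then have "mball x (1 / Suc m) \<subseteq> mball x e" by (intro mball_subset_concentric) simp
    then have "x \<in> C n (first n x) m" using e x by (auto simp: C_def)
    then show ?thesis unfolding depth_def by (rule LeastI)
  qed
  have depth_eq: "depth n x = m \<longleftrightarrow> x \<in> C n (first n x) m \<and> (\<forall>j<m. x \<notin> C n (first n x) j)" if "x \<in> M" for n x m
    using depth[OF that, of n] not_less_Least[of _ "\<lambda>m. x \<in> C n (first n x) m"]
    unfolding depth_def by (metis linorder_neqE_nat)
  define F where "F A = (SOME F :: nat \<Rightarrow> 'a set. (\<forall>k. closedin mtopology (F k)) \<and> \<Union> (range F) = A)" for A
  have F: "closedin mtopology (F A k)" "\<Union> (range (F A)) = A" if "fsigma_in mtopology A" for A k
  proof -
    have "\<exists>F :: nat \<Rightarrow> 'a set. (\<forall>k. closedin mtopology (F k)) \<and> \<Union> (range F) = A"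
      using that unfolding fsigma_in_ascending by blast
    from someI_ex[OF this] show "closedin mtopology (F A k)" "\<Union> (range (F A)) = A"
      by (auto simp: F_def)
  qed
  \<comment> \<open>Splitting a piece by \<open>idx\<close> puts each part into one closed subset of
    the piece. This is what keeps limits of the next level inside the current one.\<close>
  define idx where "idx A x = (LEAST k. x \<in> F A k)" for A x
  have idx: "x \<in> F A (idx A x)" if "fsigma_in mtopology A" "x \<in> A" for A x
  proof -
    have "\<exists>k. x \<in> F A k" using F(2)[OF that(1)] that(2) by blast
    then show ?thesis unfolding idx_def by (rule LeastI_ex)
  qed
  have idx_eq: "idx A x = k \<longleftrightarrow> x \<in> F A k \<and> (\<forall>j<k. x \<notin> F A j)" if "fsigma_in mtopology A" "x \<in> A" for A x k
    using idx[OF that] not_less_Least[of _ "\<lambda>k. x \<in> F A k"]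
    unfolding idx_def by (metis linorder_neqE_nat)
  define N where "N = rec_nat (\<lambda>x. M) (\<lambda>n f x. {y \<in> f x. idx (f x) y = idx (f x) x \<and> first n y = first n x \<and> depth n y = depth n x})"
  have N0: "N 0 x = M" and NS: "N (Suc n) x = {y \<in> N n x. idx (N n x) y = idx (N n x) x \<and> first n y = first n x \<and> depth n y = depth n x}" for n x
    by (simp_all add: N_def)
  have N_M: "N n x \<subseteq> M" for n x by (induction n) (auto simp: N0 NS)
  have N_self: "x \<in> N n x" if "x \<in> M" for n x by (induction n) (auto simp: N0 NS that)
  have N_eq: "N n y = N n x" if "y \<in> N n x" for n x y
    using that by (induction n) (auto simp: N0 NS)
  have N_fsigma: "fsigma_in mtopology (N n x)" for n x
  proof (induction n)
    case 0
    then show ?case using fsigma_in_topspace[of mtopology] by (simp add: N0)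
  next
    case (Suc n)
    let ?A = "N n x" and ?k = "idx (N n x) x" and ?e = "first n x" and ?m = "depth n x"
    have gd: "gdelta_in mtopology (\<Union>j<k. S j)" if "\<And>j. closedin mtopology (S j)" for S :: "nat \<Rightarrow> 'a set" and k
      by (intro closed_imp_gdelta_in metrizable_space_mtopology closedin_Union) (use that in auto)
    have 1: "fsigma_in mtopology (F ?A ?k - (\<Union>j<?k. F ?A j))"
      by (intro fsigma_in_diff closed_imp_fsigma_in F gd Suc)
    \<comment> \<open>However many earlier centres there are, the union of their balls is open, so
      this is a difference of two open sets.\<close>
    have 2: "fsigma_in mtopology (B n ?e - \<Union> {B n y' |y'. (y', ?e) \<in> r - Id})"
      by (intro fsigma_in_diff open_imp_fsigma_in open_imp_gdelta_in openin_Union metrizable_space_mtopology Bopen)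
         (use Bopen in auto)
    have 3: "fsigma_in mtopology (C n ?e ?m - (\<Union>j<?m. C n ?e j))"
      by (intro fsigma_in_diff closed_imp_fsigma_in Cclosed gd)
    have "N (Suc n) x = ?A \<inter> ((F ?A ?k - (\<Union>j<?k. F ?A j)) \<inter> ((B n ?e - \<Union> {B n y' |y'. (y', ?e) \<in> r - Id}) \<inter>
        (C n ?e ?m - (\<Union>j<?m. C n ?e j))))" (is "_ = ?R")
    proof (rule set_eqI)
      fix y
      show "y \<in> N (Suc n) x \<longleftrightarrow> y \<in> ?R"
      proof (cases "y \<in> ?A")
        case True
        then have yM: "y \<in> M" using N_M by blast
        have a: "idx ?A y = ?k \<longleftrightarrow> y \<in> F ?A ?k - (\<Union>j<?k. F ?A j)" using idx_eq[OF Suc True] by auto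
        have b: "first n y = ?e \<longleftrightarrow> y \<in> B n ?e - \<Union> {B n y' |y'. (y', ?e) \<in> r - Id}"
          unfolding first_eq[OF yM] by auto
        have c: "depth n y = ?m \<longleftrightarrow> y \<in> C n ?e ?m - (\<Union>j<?m. C n ?e j)" if "first n y = ?e"
          unfolding depth_eq[OF yM] that by auto
        show ?thesis using True a b c unfolding NS by blast
      qed (auto simp: NS)
    qed
    then show ?case by (simp only:) (intro fsigma_in_Int 1 2 3 Suc)
  qed
  have N_small: "d x y < 2 / Suc n" if x: "x \<in> M" and y: "y \<in> N (Suc n) x" for n x y
  proof -
    have yM: "y \<in> M" using y N_M by blast
    have "y \<in> B n (first n x)" "x \<in> B n (first n x)" using first(1)[OF x, of n] first(1)[OF yM, of n] y by (auto simp: NS)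
    then have a: "first n x \<in> M" "d (first n x) x < 1 / Suc n" "d (first n x) y < 1 / Suc n" by (auto simp: B_def)
    have "d x y \<le> d (first n x) x + d (first n x) y" using triangle''[OF x a(1) yM] .
    then show ?thesis using a by simp
  qed
  have N_limit: "x \<in> N n z" if z: "z \<in> M" and lim: "limitin mtopology s x sequentially"
      and ev: "\<forall>\<^sub>F i in sequentially. s i \<in> N (Suc n) z" for n x z s
  proof -
    have sub: "N (Suc n) z \<subseteq> F (N n z) (idx (N n z) z)"
    proof
      fix y assume "y \<in> N (Suc n) z"
      then have "y \<in> N n z" "idx (N n z) y = idx (N n z) z" by (auto simp: NS)
      then show "y \<in> F (N n z) (idx (N n z) z)" using idx[OF N_fsigma, of y n z] by simp
    qed
    have "\<forall>\<^sub>F i in sequentially. s i \<in> F (N n z) (idx (N n z) z)"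
      by (rule eventually_mono[OF ev]) (rule subsetD[OF sub])
    then have "x \<in> F (N n z) (idx (N n z) z)"
      using limitin_closedin[OF lim F(1)[OF N_fsigma]] by simp
    then show ?thesis using F(2)[OF N_fsigma, of n z] by blast
  qed
  have rp: "refining_partitions M N"
  proof
    show "N n x \<subseteq> M" for n x by (rule N_M)
    show "x \<in> N n x" if "x \<in> M" for n x using N_self that .
    show "N n y = N n x" if "y \<in> N n x" for n x y using N_eq that .
    show "N (Suc n) x \<subseteq> N n x" for n x by (auto simp: NS)
    show "N 0 x = M" for x by (rule N0)
    show "y = x" if x: "x \<in> M" and all: "\<And>n. y \<in> N n x" for x y
    proof (rule ccontr)
      assume "y \<noteq> x"
      moreover have "y \<in> M" using all N0 by blast
      ultimately have "d x y / 2 > 0" using x by simp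
      then obtain n where "1 / Suc n < d x y / 2" by (meson nat_approx_posE)
      then have "2 / Suc n < d x y" by (simp add: field_simps)
      then show False using N_small[OF x all[of "Suc n"]] by simp
    qed
    show "\<exists>x\<in>M. \<forall>n. s n \<in> N n x" if s: "\<And>n. s n \<in> M" "\<And>n. s (Suc n) \<in> N n (s n)" for s
    proof -
      have sj: "s j \<in> N n (s n)" if "n \<le> j" for n j
        using that
      proof (induction j rule: dec_induct)
        case base
        then show ?case using N_self s(1) by blast
      next
        case (step j)
        have mono: "N j z \<subseteq> N n z" for z using step(1) by (induction j rule: dec_induct) (auto simp: NS)
        have "s (Suc j) \<in> N n (s j)" using s(2)[of j] mono by blast
        then show ?case using N_eq step(3) by blast
      qed
      have "MCauchy s"
        unfolding MCauchy_def
      proof (intro conjI allI impI)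
        show "range s \<subseteq> M" using s by auto
        fix e :: real assume "e > 0"
        then have "e / 4 > 0" by simp
        then obtain n where "1 / Suc n < e / 4" by (meson nat_approx_posE)
        then have n: "4 / Suc n < e" by (simp add: field_simps)
        have cl: "d (s (Suc n)) (s i) < 2 / Suc n" if "Suc n \<le> i" for i
          using N_small[OF s(1) sj[OF that]] .
        have "d (s i) (s j) < e" if "Suc n \<le> i" "Suc n \<le> j" for i j
          using triangle''[OF s(1)[of i] s(1)[of "Suc n"] s(1)[of j]] cl[OF that(1)] cl[OF that(2)] n by simp
        then show "\<exists>K. \<forall>i j. K \<le> i \<longrightarrow> K \<le> j \<longrightarrow> d (s i) (s j) < e" by blast
      qed
      then obtain x where lim: "limitin mtopology s x sequentially" using compl unfolding mcomplete_def by blast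
      have xM: "x \<in> M" using limitin_topspace[OF lim] by simp
      have "s n \<in> N n x" for n
      proof -
        have "\<forall>\<^sub>F i in sequentially. s i \<in> N (Suc n) (s (Suc n))"
          unfolding eventually_sequentially using sj[of "Suc n"] by blast
        \<comment> \<open>The index drops by one: a limit of points of a piece of level
          \<open>Suc n\<close> lies only in the enclosing piece of level \<open>n\<close>.\<close>
        then have "x \<in> N n (s (Suc n))" by (rule N_limit[OF s(1) lim])
        then have "N n x = N n (s n)" using N_eq s(2) by metis
        then show ?thesis using N_self s(1) by simp
      qed
      then show ?thesis using xM by blast
    qed
  qed
  \<comment> \<open>The code keeps the data with countably many values and omits
    \<open>first\<close>. Hence two points with the same code but different pieces have different
    centres at some earlier level at which their pieces still agree.\<close>
  define c where "c = rec_nat (\<lambda>x. 0::nat) (\<lambda>n f x. prod_encode (f x, prod_encode (idx (N n x) x, depth n x)))"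
  have cS: "c (Suc n) x = prod_encode (c n x, prod_encode (idx (N n x) x, depth n x))" for n x
    by (simp add: c_def)
  have sep: "\<exists>e>0. \<forall>x\<in>M. \<forall>y\<in>M. c n x = v \<longrightarrow> c n y = v \<longrightarrow> N n x \<noteq> N n y \<longrightarrow> e \<le> d x y" for n v
  proof (induction n arbitrary: v)
    case 0
    show ?case by (rule exI[of _ 1]) (simp add: N0)
  next
    case (Suc n)
    obtain v' k m where v: "v = prod_encode (v', prod_encode (k, m))"
      by (metis prod_decode_inverse surj_pair)
    obtain e where e: "e > 0" "\<And>x y. x \<in> M \<Longrightarrow> y \<in> M \<Longrightarrow> c n x = v' \<Longrightarrow> c n y = v' \<Longrightarrow> N n x \<noteq> N n y \<Longrightarrow> e \<le> d x y"
      using Suc[of v'] by blast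
    \<comment> \<open>A point \<open>y\<close> with a later centre lies outside
      \<open>B n (first n x)\<close>, whereas the ball of radius \<open>1 / Suc m\<close> around
      \<open>x\<close> lies inside.\<close>
    have lt: "1 / Suc m \<le> d x y"
      if x: "x \<in> M" "y \<in> M" "depth n x = m" "(first n x, first n y) \<in> r - Id" for x y
    proof (rule ccontr)
      assume "\<not> 1 / Suc m \<le> d x y"
      then have "y \<in> mball x (1 / Suc m)" using x by simp
      then have "y \<in> B n (first n x)" using depth[OF x(1), of n] x(3) by (auto simp: C_def)
      then show False using first(2)[OF x(2) x(4)] by blast
    qed
    show ?case
    proof (intro exI[of _ "min e (1 / Suc m)"] conjI ballI impI)
      show "0 < min e (1 / Suc m)" using e(1) by simp
      fix x y assume xy: "x \<in> M" "y \<in> M" "c (Suc n) x = v" "c (Suc n) y = v" "N (Suc n) x \<noteq> N (Suc n) y"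
      have ks: "c n x = v'" "c n y = v'" "idx (N n x) x = k" "idx (N n y) y = k" "depth n x = m" "depth n y = m"
        using xy(3,4) by (auto simp: cS v)
      show "min e (1 / Suc m) \<le> d x y"
      proof (cases "N n x = N n y")
        case True
        have "first n x \<noteq> first n y"
        proof
          assume "first n x = first n y"
          then have "N (Suc n) x = N (Suc n) y" using True ks by (simp add: NS)
          then show False using xy(5) by simp
        qed
        then consider "(first n x, first n y) \<in> r - Id" | "(first n y, first n x) \<in> r - Id" using tot by blast
        then have "1 / Suc m \<le> d x y"
          using lt[OF xy(1,2) ks(5)] lt[OF xy(2,1) ks(6)] commute[of x y] by cases auto
        then show ?thesis by simp
      next
        case False
        then show ?thesis using e(2)[OF xy(1,2) ks(1,2)] by simp
      qed
    qed
  qed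
  show ?thesis by (rule that[OF rp N_small sep])
qed

end

section \<open>Absorbing a sigma-discrete set\<close>

context Metric_space
begin

text \<open>The sequence with \<open>k\<close> entries True, then False, then \<open>w\<close> goes
  to \<open>f k w\<close>, and the constant sequence True goes to \<open>x\<close>. The shrinking
  distances give continuity at the latter.\<close>

lemma cantor_emb_append_sequence:
  assumes x: "x \<in> M" and emb: "\<And>k. cantor_emb mtopology (f k)"
    and near: "\<And>k w. d x (f k w) < 1 / Suc k"
    and ne: "\<And>k w. f k w \<noteq> x"
    and disj: "\<And>j k v w. f j v = f k w \<Longrightarrow> j = k"
  obtains g where "cantor_emb mtopology g" "range g = insert x (\<Union>k. range (f k))"
proof -
  define z where "z b = (LEAST i. \<not> b i)" for b :: "nat \<Rightarrow> bool"
  define t where "t b = (\<lambda>i. b (Suc (i + z b)))" for b :: "nat \<Rightarrow> bool"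
  define g where "g b = (if \<forall>i. b i then x else f (z b) (t b))" for b
  have zI: "\<not> b (z b)" if "\<not> (\<forall>i. b i)" for b :: "nat \<Rightarrow> bool"
    unfolding z_def by (rule LeastI_ex) (use that in simp)
  have zlt: "b i" if "i < z b" for b :: "nat \<Rightarrow> bool" and i
    using that not_less_Least unfolding z_def by blast
  have zeq: "z b = k" if "\<not> b k" "\<And>i. i < k \<Longrightarrow> b i" for b :: "nat \<Rightarrow> bool" and k
    using zI[of b] zlt[of k b] that by (metis linorder_neqE_nat)
  have finj: "f k v = f k w \<Longrightarrow> v = w" and fcont: "continuous_map cantor_space mtopology (f k)" for k v w
    using emb[of k] by (auto simp: cantor_emb_def inj_def)
  have fM: "f k w \<in> M" for k w using fcont[of k] by (auto simp: continuous_map_def)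
  have "inj g"
  proof (rule injI)
    fix b b' assume e: "g b = g b'"
    consider "\<forall>i. b i" "\<forall>i. b' i" | "\<not> (\<forall>i. b i)" "\<not> (\<forall>i. b' i)"
      using e ne by (metis g_def)
    then show "b = b'"
    proof cases
      case 2
      then have "f (z b) (t b) = f (z b') (t b')" using e unfolding g_def by metis
      then have z: "z b = z b'" and t: "t b = t b'" using disj finj by metis+
      show ?thesis
      proof
        fix i
        consider "i < z b" | "i = z b" | "z b < i" by linarith
        then show "b i = b' i"
        proof cases
          case 1 then show ?thesis using zlt[of i b] zlt[of i b'] z by simp
        next
          case c2: 2 then show ?thesis using zI[OF 2(1)] zI[OF 2(2)] z by simp
        next
          case 3
          then obtain j where "i = Suc (j + z b)" by (metis add.commute less_imp_Suc_add)
          then show ?thesis using fun_cong[OF t, of j] z by (simp add: t_def)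
        qed
      qed
    qed auto
  qed
  moreover have "continuous_map cantor_space mtopology g"
    unfolding continuous_map_cantor_metric
  proof (intro conjI allI impI)
    show "range g \<subseteq> M" using x fM by (auto simp: g_def)
    fix b :: "nat \<Rightarrow> bool" and e :: real assume e: "e > 0"
    show "\<exists>n. \<forall>b'. agree n b b' \<longrightarrow> d (g b) (g b') < e"
    proof (cases "\<forall>i. b i")
      case True
      obtain n where n: "1 / Suc n < e" using e by (meson nat_approx_posE)
      have "d (g b) (g b') < e" if a: "agree n b b'" for b'
      proof (cases "\<forall>i. b' i")
        case False
        have "n \<le> z b'" using zI[OF False] a True by (metis agree_def not_le)
        then have "1 / real (Suc (z b')) \<le> 1 / Suc n" by (simp add: field_simps)
        moreover have "g b = x" "g b' = f (z b') (t b')"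
          unfolding g_def by (rule if_P[OF True], rule if_not_P[OF False])
        ultimately show ?thesis using near[of "z b'" "t b'"] n by simp
      qed (use True x e in \<open>simp add: g_def\<close>)
      then show ?thesis by blast
    next
      case False
      obtain n where n: "\<And>w. agree n (t b) w \<Longrightarrow> d (f (z b) (t b)) (f (z b) w) < e"
        using fcont[of "z b"] e unfolding continuous_map_cantor_metric by blast
      have "d (g b) (g b') < e" if a: "agree (Suc (z b) + n) b b'" for b'
      proof -
        have same: "b' i = b i" if "i < Suc (z b) + n" for i using a that by (simp add: agree_def)
        have "z b' = z b"
        proof (rule zeq)
          show "\<not> b' (z b)" using zI[OF False] same[of "z b"] by simp
          show "b' i" if "i < z b" for i using zlt[OF that] same[of i] that by simp
        qed
        moreover have "\<not> (\<forall>i. b' i)" using zI[OF False] same[of "z b"] by auto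
        moreover have "agree n (t b) (t b')" using same calculation(1) by (simp add: agree_def t_def)
        ultimately show ?thesis using n[of "t b'"] False by (auto simp: g_def)
      qed
      then show ?thesis by blast
    qed
  qed
  moreover have "range g = insert x (\<Union>k. range (f k))"
  proof (intro equalityI subsetI)
    fix y assume "y \<in> insert x (\<Union>k. range (f k))"
    then consider "y = x" | k w where "y = f k w" by blast
    then show "y \<in> range g"
    proof cases
      case 1
      then have "y = g (\<lambda>_. True)" by (simp add: g_def)
      then show ?thesis by blast
    next
      case 2
      define b where "b i = (if i < k then True else if i = k then False else w (i - Suc k))" for i
      have zb: "z b = k" by (rule zeq) (auto simp: b_def)
      have "\<not> (\<forall>i. b i)" unfolding b_def by auto
      moreover have "t b = w" by (auto simp: t_def zb b_def)
      ultimately have "y = g b" using 2 zb by (auto simp: g_def)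
      then show ?thesis by blast
    qed
  qed (auto simp: g_def)
  ultimately show ?thesis using that by (simp add: cantor_emb_def)
qed

text \<open>Every \<open>x\<close> in \<open>E\<close> receives a sequence of pieces converging to
  it, each a cylinder in a fibre of some \<open>h\<close>. The assignment of fibres to pairs
  \<open>(x, k)\<close> is injective, so no fibre is cut twice.\<close>

lemma cantor_decomposable_absorb:
  fixes H :: "((nat \<Rightarrow> bool) \<Rightarrow> 'a) set" and l :: "'a \<Rightarrow> nat"
  defines "E \<equiv> M - (\<Union>h\<in>H. range h)"
  assumes emb: "\<And>h. h \<in> H \<Longrightarrow> cantor_emb mtopology h"
    and disj: "\<And>h h' b b'. h \<in> H \<Longrightarrow> h' \<in> H \<Longrightarrow> h b = h' b' \<Longrightarrow> h = h'"
    and sep: "\<And>n. \<exists>e>0. \<forall>x\<in>E. \<forall>y\<in>E. l x = n \<longrightarrow> l y = n \<longrightarrow> x \<noteq> y \<longrightarrow> e \<le> d x y"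
    and dense: "\<And>x e. x \<in> E \<Longrightarrow> e > 0 \<Longrightarrow> \<exists>h\<in>H. \<exists>b. d x (h b) < e"
  shows "cantor_decomposable mtopology M"
proof -
  have EM: "E \<subseteq> M" by (auto simp: E_def)
  have hinj: "h b = h b' \<Longrightarrow> b = b'" and hM: "h b \<in> M" if "h \<in> H" for h b b'
    using emb[OF that] by (auto simp: cantor_emb_def inj_def continuous_map_def)
  have hE: "h b \<notin> E" if "h \<in> H" for h b using that by (auto simp: E_def)
  from sep have "\<forall>n. \<exists>e. e > 0 \<and> (\<forall>x\<in>E. \<forall>y\<in>E. l x = n \<longrightarrow> l y = n \<longrightarrow> x \<noteq> y \<longrightarrow> e \<le> d x y)" by blast
  from choice[OF this] obtain \<epsilon> where \<epsilon>': "\<forall>n. \<epsilon> n > 0 \<and> (\<forall>x\<in>E. \<forall>y\<in>E. l x = n \<longrightarrow> l y = n \<longrightarrow> x \<noteq> y \<longrightarrow> \<epsilon> n \<le> d x y)" ..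
  have \<epsilon>0: "\<epsilon> n > 0" for n using \<epsilon>' by blast
  have \<epsilon>: "\<epsilon> (l x) \<le> d x y" if "x \<in> E" "y \<in> E" "l x = l y" "x \<noteq> y" for x y using \<epsilon>' that by metis
  \<comment> \<open>Half of \<epsilon> makes the balls around points of \<open>E\<close> with equal
    labels disjoint; \<open>1 / Suc k\<close> makes the pieces converge to \<open>x\<close>.\<close>
  define \<rho> where "\<rho> x k = min (\<epsilon> (l x) / 2) (1 / Suc k)" for x and k :: nat
  have \<rho>: "\<rho> x k > 0" "\<rho> x k \<le> \<epsilon> (l x) / 2" "\<rho> x k \<le> 1 / Suc k" for x k using \<epsilon>0 by (simp_all add: \<rho>_def)
  \<comment> \<open>The prefix length is taken even, so that it consists of \<open>L\<close> even
    and \<open>L\<close> odd places.\<close>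
  have "\<exists>h a L. h \<in> H \<and> (\<forall>b. agree (2 * L) a b \<longrightarrow> d x (h b) < \<rho> x k)" if x: "x \<in> E" for x k
  proof -
    obtain h a where h: "h \<in> H" "d x (h a) < \<rho> x k" using dense[OF x \<rho>(1)[of x k]] by blast
    have c: "continuous_map cantor_space mtopology h" using emb[OF h(1)] by (simp add: cantor_emb_def)
    have "\<rho> x k - d x (h a) > 0" using h by simp
    then obtain n where n: "\<And>b. agree n a b \<Longrightarrow> d (h a) (h b) < \<rho> x k - d x (h a)"
      using c unfolding continuous_map_cantor_metric by blast
    have "d x (h b) < \<rho> x k" if "agree (2 * n) a b" for b
    proof -
      have "agree n a b" using that by (simp add: agree_def)
      then show ?thesis using n[of b] triangle[of x "h a" "h b"] x EM hM[OF h(1)] by fastforce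
    qed
    then show ?thesis using h(1) by blast
  qed
  then have "\<forall>x k. \<exists>h a L. x \<in> E \<longrightarrow> h \<in> H \<and> (\<forall>b. agree (2 * L) a b \<longrightarrow> d x (h b) < \<rho> x k)" by meson
  then obtain hh aa and LL :: "'a \<Rightarrow> nat \<Rightarrow> nat" where
    hh': "\<forall>x k. x \<in> E \<longrightarrow> hh x k \<in> H \<and> (\<forall>b. agree (2 * LL x k) (aa x k) b \<longrightarrow> d x (hh x k b) < \<rho> x k)"
    unfolding choice_iff by (elim exE)
  have hh: "hh x k \<in> H" if "x \<in> E" for x k using hh' that by blast
  have near: "d x (hh x k b) < \<rho> x k" if "x \<in> E" "agree (2 * LL x k) (aa x k) b" for x k b using hh' that by blast
  \<comment> \<open>Pieces inside the same \<open>h\<close> must lie in different fibres: the tails of the parameters \<open>zz\<close> are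
    indicators of the pairwise disjoint sets \<open>{prod_encode (n, m) | m}\<close> with \<open>n\<close> given by \<open>code\<close>.\<close>
  define code where "code x k = to_nat (l x, k, map (aa x k) [0..<2 * LL x k])" for x k
  \<comment> \<open>The point \<open>x\<close> has no code of its own, but equal codes give equal
    prefixes. Then \<open>hh y j (aa y j)\<close> is near both \<open>x\<close> and
    \<open>y\<close>, which have the same label, and the separation forces
    \<open>x = y\<close>.\<close>
  have code_inj: "x = y \<and> k = j" if x: "x \<in> E" "y \<in> E" and e: "hh x k = hh y j" "code x k = code y j" for x y k j
  proof -
    have c: "l x = l y" "k = j" "map (aa x k) [0..<2 * LL x k] = map (aa y j) [0..<2 * LL y j]"
      using e(2) by (auto simp: code_def)
    have L: "LL x k = LL y j" using arg_cong[OF c(3), of length] by simp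
    have "aa x k i = aa y j i" if "i < 2 * LL x k" for i
      using arg_cong[OF c(3), of "\<lambda>xs. xs ! i"] that L by simp
    then have "agree (2 * LL x k) (aa x k) (aa y j)" by (simp add: agree_def)
    then have a: "d x (hh y j (aa y j)) < \<rho> x k" using near[OF x(1)] e(1) by metis
    have b: "d y (hh y j (aa y j)) < \<rho> y j" using near[OF x(2)] by simp
    have "d x y < \<epsilon> (l x)"
      using triangle'[of x "hh y j (aa y j)" y] a b \<rho>(2)[of x k] \<rho>(2)[of y j] c(1) x EM hM[OF hh[OF x(2)]] by fastforce
    then show ?thesis using \<epsilon>[OF x c(1)] c(2) by fastforce
  qed
  define zz where "zz x k i = (if i < LL x k then aa x k (2 * i + 1) else fst (prod_decode i) = code x k)" for x k i
  have zz_inj: "x = y \<and> k = j" if x: "x \<in> E" "y \<in> E" and e: "hh x k = hh y j" "zz x k = zz y j" for x y k j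
  proof -
    \<comment> \<open>The second component pushes \<open>i\<close> beyond both prefixes, where the
      two sequences are indicators.\<close>
    define i where "i = prod_encode (code x k, LL x k + LL y j)"
    have "LL x k + LL y j \<le> i" unfolding i_def by (rule le_prod_encode_2)
    then have "zz x k i = (code x k = code x k)" "zz y j i = (code x k = code y j)" by (auto simp: zz_def i_def)
    then show ?thesis using code_inj[OF x e(1)] e(2) by simp
  qed
  \<comment> \<open>The odd places of the prefix are already built into \<open>zz x k\<close>.
    Prescribing the even ones confines the fibre to the cylinder that \<open>hh x k\<close> maps
    close to \<open>x\<close>.\<close>
  define piece where "piece x k w = hh x k (weave (zz x k) (cons_prefix (LL x k) (\<lambda>i. aa x k (2 * i)) w))" for x k w
  have piece_emb: "cantor_emb mtopology (piece x k)" if "x \<in> E" for x k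
    unfolding piece_def by (intro cantor_emb_cons_prefix[of _ "\<lambda>w. hh x k (weave (zz x k) w)"] cantor_emb_weave emb hh that)
  have piece_near: "d x (piece x k w) < \<rho> x k" if "x \<in> E" for x k w
    unfolding piece_def
  proof (rule near[OF that], unfold agree_def, intro allI impI)
    fix i assume i: "i < 2 * LL x k"
    show "weave (zz x k) (cons_prefix (LL x k) (\<lambda>i. aa x k (2 * i)) w) i = aa x k i"
      by (cases "even i") (use i in \<open>auto simp: weave_def cons_prefix_def zz_def elim!: evenE oddE\<close>)
  qed
  have piece_disj: "x = y \<and> k = j" if x: "x \<in> E" "y \<in> E" and e: "piece x k w = piece y j v" for x y k j w v
  proof -
    have h: "hh x k = hh y j" using disj[OF hh[OF x(1)] hh[OF x(2)]] e unfolding piece_def by blast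
    then have "zz x k = zz y j" using e hinj[OF hh[OF x(2)]] unfolding piece_def by (metis weave_eq_iff)
    then show ?thesis using zz_inj[OF x h] by blast
  qed
  have "\<exists>g. cantor_emb mtopology g \<and> range g = insert x (\<Union>k. range (piece x k))" if x: "x \<in> E" for x
  proof (rule cantor_emb_append_sequence[of x "piece x"])
    show "x \<in> M" using x EM by blast
    show "cantor_emb mtopology (piece x k)" for k by (rule piece_emb[OF x])
    show "d x (piece x k w) < 1 / Suc k" for k w using piece_near[OF x, of k w] \<rho>(3)[of x k] by linarith
    show "piece x k w \<noteq> x" for k w using hE[OF hh[OF x]] x unfolding piece_def by metis
    show "j = k" if "piece x j v = piece x k w" for j k v w using piece_disj[OF x x that] by blast
  qed blast
  then have K: "cantor_decomposable mtopology (insert x (\<Union>k. range (piece x k)))" if "x \<in> E" for x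
    using cantor_decomposable_range[OF Hausdorff_space_mtopology] that by metis
  define fib where "fib h z = range (\<lambda>w. h (weave z w))" for h :: "(nat \<Rightarrow> bool) \<Rightarrow> 'a" and z
  define P where "P = (\<Union>x\<in>E. \<Union>k. range (piece x k))"
  have piece_fib: "range (piece x k) \<subseteq> fib (hh x k) (zz x k)" for x k by (auto simp: piece_def fib_def)
  have fib_eq: "h = h' \<and> z = z'" if hf: "h \<in> H" "h' \<in> H" "y \<in> fib h z" "y \<in> fib h' z'" for h h' z z' y
  proof -
    obtain w where w: "y = h (weave z w)" using hf(3) unfolding fib_def by blast
    obtain w' where w': "y = h' (weave z' w')" using hf(4) unfolding fib_def by blast
    note e = w w'
    then have "h = h'" using disj[OF hf(1,2)] by metis
    then show ?thesis using e hinj[OF hf(1)] by (metis weave_eq_iff)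
  qed
  \<comment> \<open>A fibre contains at most one piece, and that piece is a cylinder of the fibre,
    so the rest is a finite union of disjoint Cantor sets.\<close>
  have fib_dec: "cantor_decomposable mtopology (fib h z - P)" if h: "h \<in> H" for h z
  proof (cases "\<exists>x\<in>E. \<exists>k. hh x k = h \<and> zz x k = z")
    case True
    then obtain x k where x: "x \<in> E" "hh x k = h" "zz x k = z" by blast
    have "fib h z \<inter> P = range (piece x k)"
    proof (intro equalityI subsetI)
      fix y assume y: "y \<in> fib h z \<inter> P"
      then obtain x' k' where x': "x' \<in> E" "y \<in> range (piece x' k')" by (auto simp: P_def)
      then have "y \<in> fib (hh x' k') (zz x' k')" using piece_fib by blast
      then have "h = hh x' k' \<and> z = zz x' k'" using fib_eq[OF h hh[OF x'(1)]] y by blast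
      then show "y \<in> range (piece x k)" using zz_inj[OF x(1) x'(1)] x x'(2) by blast
    next
      fix y assume "y \<in> range (piece x k)"
      then show "y \<in> fib h z \<inter> P" using piece_fib[of x k] x by (auto simp: P_def)
    qed
    then have "fib h z - P = fib h z - range (piece x k)" by blast
    moreover have "cantor_decomposable mtopology (fib h z - range (piece x k))"
      unfolding fib_def piece_def x(2,3)
      by (rule cantor_decomposable_remove_cylinder[OF Hausdorff_space_mtopology cantor_emb_weave[OF emb[OF h]]])
    ultimately show ?thesis by simp
  next
    case False
    have "fib h z \<inter> P = {}"
    proof (rule ccontr)
      assume "fib h z \<inter> P \<noteq> {}"
      then obtain y x k where y: "y \<in> fib h z" "x \<in> E" "y \<in> range (piece x k)" by (auto simp: P_def)
      then have "y \<in> fib (hh x k) (zz x k)" using piece_fib by blast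
      then show False using fib_eq[OF h hh[OF y(2)] y(1)] False y(2) by blast
    qed
    then have "fib h z - P = fib h z" by blast
    then show ?thesis unfolding fib_def
      using cantor_decomposable_range[OF Hausdorff_space_mtopology cantor_emb_weave[OF emb[OF h]]] by simp
  qed
  define A where "A i = (case i of Inl x \<Rightarrow> insert x (\<Union>k. range (piece x k)) | Inr (h, z) \<Rightarrow> fib h z - P)" for i
  define I where "I = E <+> (H \<times> (UNIV :: (nat \<Rightarrow> bool) set))"
  have "cantor_decomposable mtopology (\<Union>i\<in>I. A i)"
  proof (rule cantor_decomposable_UN)
    show "cantor_decomposable mtopology (A i)" if "i \<in> I" for i
      using that K fib_dec by (auto simp: I_def A_def)
    have pieceE: "piece x k w \<notin> E" if "x \<in> E" for x k w using hE[OF hh[OF that]] by (simp add: piece_def)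
    have fibE: "fib h z \<inter> E = {}" if "h \<in> H" for h z using hE[OF that] by (auto simp: fib_def)
    have d1: "A (Inl x) \<inter> A (Inl y) = {}" if "x \<in> E" "y \<in> E" "x \<noteq> y" for x y
      using piece_disj[OF that(1,2)] pieceE[OF that(1)] pieceE[OF that(2)] that by (auto simp: A_def)
    have d2: "A (Inl x) \<inter> A (Inr p) = {}" if "x \<in> E" "p \<in> H \<times> UNIV" for x p
      using that fibE[of "fst p" "snd p"] by (auto simp: A_def P_def)
    have d3: "A (Inr p) \<inter> A (Inr q) = {}" if "p \<in> H \<times> UNIV" "q \<in> H \<times> UNIV" "p \<noteq> q" for p q
      using that fib_eq by (fastforce simp: A_def)
    show "A i \<inter> A j = {}" if ij: "i \<in> I" "j \<in> I" "i \<noteq> j" for i j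
    proof (cases i; cases j)
      fix x y assume "i = Inl x" "j = Inl y"
      moreover from this have "x \<in> E" "y \<in> E" "x \<noteq> y" using ij by (auto simp: I_def)
      ultimately show ?thesis using d1[of x y] by simp
    next
      fix x p assume "i = Inl x" "j = Inr p"
      moreover from this have "x \<in> E" "p \<in> H \<times> UNIV" using ij by (auto simp: I_def)
      ultimately show ?thesis using d2[of x p] by simp
    next
      fix p x assume "i = Inr p" "j = Inl x"
      moreover from this have "x \<in> E" "p \<in> H \<times> UNIV" using ij by (auto simp: I_def)
      ultimately show ?thesis using d2[of x p] by (simp add: Int_commute)
    next
      fix p q assume "i = Inr p" "j = Inr q"
      moreover from this have "p \<in> H \<times> UNIV" "q \<in> H \<times> UNIV" "p \<noteq> q" using ij by (auto simp: I_def)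
      ultimately show ?thesis using d3[of p q] by simp
    qed
  qed
  moreover have "(\<Union>i\<in>I. A i) = M"
  proof (intro equalityI subsetI)
    fix y assume "y \<in> (\<Union>i\<in>I. A i)"
    then show "y \<in> M" using EM hM hh by (auto simp: I_def A_def piece_def fib_def)
  next
    fix y assume y: "y \<in> M"
    consider "y \<in> E" | "y \<in> P" | h b where "h \<in> H" "y = h b" "y \<notin> P" using y by (auto simp: E_def)
    then show "y \<in> (\<Union>i\<in>I. A i)"
    proof cases
      case 1
      then have "y \<in> A (Inl y)" "Inl y \<in> I" by (auto simp: A_def I_def)
      then show ?thesis by blast
    next
      case 2
      then obtain x where "x \<in> E" "y \<in> A (Inl x)" by (auto simp: P_def A_def)
      then show ?thesis unfolding I_def by blast
    next
      case 3
      define z where "z i = b (2 * i + 1)" for i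
      have "weave z (\<lambda>i. b (2 * i)) = b" unfolding z_def by (rule weave_split)
      then have "y \<in> fib h z" unfolding fib_def using 3(2) by (metis rangeI)
      then have "y \<in> A (Inr (h, z))" "Inr (h, z) \<in> I" using 3 by (auto simp: A_def I_def)
      then show ?thesis by blast
    qed
  qed
  ultimately show ?thesis by simp
qed

end

section \<open>Crowded complete metric spaces\<close>

context Metric_space
begin

text \<open>The set of points of \<open>E\<close> with label \<open>n\<close> is closed, its points
  being uniformly apart, and has empty interior, no point being isolated. The Baire theorem applies
  to the complements \<open>T n\<close>.\<close>

lemma dense_complement_sigma_discrete:
  fixes l :: "'a \<Rightarrow> nat"
  assumes compl: mcomplete and iso: "\<And>x. \<not> openin mtopology {x}" and EM: "E \<subseteq> M"
    and sep: "\<And>n. \<exists>e>0. \<forall>x\<in>E. \<forall>y\<in>E. l x = n \<longrightarrow> l y = n \<longrightarrow> x \<noteq> y \<longrightarrow> e \<le> d x y"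
  shows "mtopology closure_of (M - E) = M"
proof -
  define T where "T n = M - {x \<in> E. l x = n}" for n
  have "openin mtopology (T n) \<and> mtopology closure_of T n = M" for n
  proof
    obtain e where e: "e > 0" "\<And>x y. x \<in> E \<Longrightarrow> y \<in> E \<Longrightarrow> l x = n \<Longrightarrow> l y = n \<Longrightarrow> x \<noteq> y \<Longrightarrow> e \<le> d x y"
      using sep[of n] by blast
    show "openin mtopology (T n)"
      unfolding openin_mtopology
    proof (intro conjI allI impI)
      fix y assume "y \<in> T n"
      then have yM: "y \<in> M" and yE: "y \<notin> {x \<in> E. l x = n}" by (auto simp: T_def)
      show "\<exists>r>0. mball y r \<subseteq> T n"
      proof (cases "\<exists>z\<in>E. l z = n \<and> d y z < e / 2")
        case True
        then obtain z where z: "z \<in> E" "l z = n" "d y z < e / 2" by blast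
        have zM: "z \<in> M" using z EM by blast
        \<comment> \<open>No other point of the discrete set lies within \<open>d y z\<close> of
          \<open>y\<close>: its distance to \<open>z\<close> would be below
          \<open>2 * d y z\<close>, hence below \<open>e\<close>.\<close>
        have "d y z > 0" using z yE yM zM by auto
        moreover have "w \<in> T n" if w: "w \<in> mball y (d y z)" for w
        proof (rule ccontr)
          assume "w \<notin> T n"
          then have "w \<in> E" "l w = n" using w by (auto simp: T_def)
          moreover have "w \<noteq> z" using w by auto
          ultimately have "e \<le> d w z" using e(2) z by blast
          then show False using triangle''[of w y z] w zM z(3) by auto
        qed
        ultimately show ?thesis by blast
      next
        case False
        then have "mball y (e / 2) \<subseteq> T n" by (auto simp: T_def)
        then show ?thesis using e(1) half_gt_zero by blast
      qed
    qed (auto simp: T_def)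
    show "mtopology closure_of T n = M"
    proof
      show "M \<subseteq> mtopology closure_of T n"
      proof
        fix x assume x: "x \<in> M"
        have "\<exists>y\<in>T n. y \<in> mball x r" if r: "r > 0" for r
        proof (cases "x \<in> T n")
          case True
          then show ?thesis using r x by auto
        next
          case False
          then have xE: "x \<in> E" "l x = n" using x by (auto simp: T_def)
          \<comment> \<open>An open ball is not a singleton here, and a second point within
            \<open>e\<close> of \<open>x\<close> cannot carry the label \<open>n\<close> in
            \<open>E\<close>.\<close>
          have "mball x (min r e) \<noteq> {x}" using iso[of x] openin_mball by metis
          moreover have "x \<in> mball x (min r e)" using x r e(1) by simp
          ultimately obtain y where y: "y \<in> mball x (min r e)" "y \<noteq> x" by blast
          then have "\<not> (y \<in> E \<and> l y = n)" using e(2)[of x y] xE by auto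
          then show ?thesis using y by (auto simp: T_def)
        qed
        then show "x \<in> mtopology closure_of T n" using x by (auto simp: metric_closure_of)
      qed
    qed (use closure_of_subset_topspace[of mtopology "T n"] in simp)
  qed
  then have "mtopology closure_of (\<Inter> (range T)) = M"
    by (intro metric_Baire_category[OF compl]) auto
  moreover have "\<Inter> (range T) = M - E" using EM by (auto simp: T_def)
  ultimately show ?thesis by simp
qed

lemma cantor_decomposable_if_no_isolated:
  assumes compl: mcomplete and iso: "\<And>x. \<not> openin mtopology {x}"
  shows "cantor_decomposable mtopology M"
proof -
  obtain N and c :: "nat \<Rightarrow> 'a \<Rightarrow> nat" where rp: "refining_partitions M N"
    and small: "\<And>n x y. x \<in> M \<Longrightarrow> y \<in> N (Suc n) x \<Longrightarrow> d x y < 2 / Suc n"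
    and sep: "\<And>n v. \<exists>e>0. \<forall>x\<in>M. \<forall>y\<in>M. c n x = v \<longrightarrow> c n y = v \<longrightarrow> N n x \<noteq> N n y \<longrightarrow> e \<le> d x y"
    using refining_partitions_ex[OF compl] by metis
  interpret refining_partitions M N by (rule rp)
  show ?thesis
  proof (rule cantor_scheme)
    fix H :: "((nat \<Rightarrow> bool) \<Rightarrow> 'a) set" and k l :: "'a \<Rightarrow> nat"
    assume inj: "\<And>h. h \<in> H \<Longrightarrow> inj h" and ran: "\<And>h. h \<in> H \<Longrightarrow> range h \<subseteq> M"
      and agr: "\<And>h n b b'. h \<in> H \<Longrightarrow> agree n b b' \<Longrightarrow> h b' \<in> N n (h b)"
      and dis: "\<And>h h' b b'. h \<in> H \<Longrightarrow> h' \<in> H \<Longrightarrow> h b = h' b' \<Longrightarrow> h = h'"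
      and exc: "\<And>x y. x \<in> M - (\<Union>h\<in>H. range h) \<Longrightarrow> y \<in> M - (\<Union>h\<in>H. range h) \<Longrightarrow>
        k x = k y \<Longrightarrow> N (k x) x = N (k x) y \<Longrightarrow> l x = l y \<Longrightarrow> N (l x) x = N (l x) y \<Longrightarrow> x = y"
    define E where "E = M - (\<Union>h\<in>H. range h)"
    \<comment> \<open>Two leftover points with the same label differ in one of their two nodes, at a
      common level and with a common code, so \<open>sep\<close> keeps them apart. The nodes
      themselves may be uncountably many; levels and codes are natural numbers.\<close>
    define L where "L x = to_nat (k x, c (k x) x, l x, c (l x) x)" for x
    have Lsep: "\<exists>e>0. \<forall>x\<in>E. \<forall>y\<in>E. L x = n \<longrightarrow> L y = n \<longrightarrow> x \<noteq> y \<longrightarrow> e \<le> d x y" for n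
    proof -
      obtain k0 v l0 w where n: "(k0, v, l0, w) = (from_nat n :: nat \<times> nat \<times> nat \<times> nat)" by (metis prod_cases4)
      obtain e1 where e1: "e1 > 0" "\<And>x y. x \<in> M \<Longrightarrow> y \<in> M \<Longrightarrow> c k0 x = v \<Longrightarrow> c k0 y = v \<Longrightarrow> N k0 x \<noteq> N k0 y \<Longrightarrow> e1 \<le> d x y"
        using sep[of k0 v] by blast
      obtain e2 where e2: "e2 > 0" "\<And>x y. x \<in> M \<Longrightarrow> y \<in> M \<Longrightarrow> c l0 x = w \<Longrightarrow> c l0 y = w \<Longrightarrow> N l0 x \<noteq> N l0 y \<Longrightarrow> e2 \<le> d x y"
        using sep[of l0 w] by blast
      have L: "k x = k0" "c k0 x = v" "l x = l0" "c l0 x = w" if "L x = n" for x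
      proof -
        have "(k0, v, l0, w) = (k x, c (k x) x, l x, c (l x) x)" using n that by (auto simp: L_def)
        then show "k x = k0" "c k0 x = v" "l x = l0" "c l0 x = w" by auto
      qed
      have "min e1 e2 \<le> d x y" if xy: "x \<in> E" "y \<in> E" "L x = n" "L y = n" "x \<noteq> y" for x y
      proof -
        have M: "x \<in> M" "y \<in> M" using xy by (auto simp: E_def)
        have "N k0 x \<noteq> N k0 y \<or> N l0 x \<noteq> N l0 y"
          using exc[of x y] xy(1,2,5) L[OF xy(3)] L[OF xy(4)] unfolding E_def by metis
        then show ?thesis
          using e1(2)[OF M L(2)[OF xy(3)] L(2)[OF xy(4)]] e2(2)[OF M L(4)[OF xy(3)] L(4)[OF xy(4)]] by linarith
      qed
      then show ?thesis using e1(1) e2(1) by (intro exI[of _ "min e1 e2"]) auto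
    qed
    have "mtopology closure_of (M - E) = M"
      by (rule dense_complement_sigma_discrete[OF compl iso _ Lsep]) (auto simp: E_def)
    then have dense: "\<exists>h\<in>H. \<exists>b. d x (h b) < e" if "x \<in> E" "e > 0" for x e
      using that unfolding metric_closure_of E_def by fastforce
    show ?thesis
    proof (rule cantor_decomposable_absorb[of H L, folded E_def])
      show "cantor_emb mtopology h" if h: "h \<in> H" for h
        unfolding cantor_emb_def continuous_map_cantor_metric
      proof (intro conjI allI impI)
        fix b and e :: real assume "e > 0"
        then have "e / 2 > 0" by simp
        then obtain n where "1 / Suc n < e / 2" by (meson nat_approx_posE)
        then have n: "2 / Suc n < e" by (simp add: field_simps)
        have "d (h b) (h b') < e" if "agree (Suc n) b b'" for b'
          using small[OF _ agr[OF h that]] ran[OF h] n by fastforce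
        then show "\<exists>n. \<forall>b'. agree n b b' \<longrightarrow> d (h b) (h b') < e" by blast
      qed (use inj[OF h] ran[OF h] in auto)
      show "h = h'" if "h \<in> H" "h' \<in> H" "h b = h' b'" for h h' b b' using dis that .
      show "\<exists>e>0. \<forall>x\<in>E. \<forall>y\<in>E. L x = n \<longrightarrow> L y = n \<longrightarrow> x \<noteq> y \<longrightarrow> e \<le> d x y" for n by (rule Lsep)
      show "\<exists>h\<in>H. \<exists>b. d x (h b) < e" if "x \<in> E" "e > 0" for x e using dense that .
    qed
  qed
qed

end

section \<open>Isolated points and the equivalence\<close>

lemma cantor_coverable_not_isolated:
  assumes "cantor_coverable X"
  shows "\<not> isolated_point X x"
proof
  assume "isolated_point X x"
  then have x: "x \<in> topspace X" "openin X {x}" by (auto simp: isolated_point_def)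
  obtain F where F: "\<Union>F = topspace X" "\<And>C. C \<in> F \<Longrightarrow> subtopology X C homeomorphic_space cantor_space"
    using assms unfolding cantor_coverable_def by blast
  obtain C where C: "C \<in> F" "x \<in> C" using x F(1) by blast
  obtain f where f: "homeomorphic_map (subtopology X C) cantor_space f"
    using F(2)[OF C(1)] unfolding homeomorphic_space by blast
  have "openin (subtopology X C) {x}"
    using x(2) C(2) unfolding openin_subtopology by (intro exI[of _ "{x}"]) auto
  then have "openin cantor_space (f ` {x})"
    using homeomorphic_imp_open_map[OF f] unfolding open_map_def by blast
  then show False using cantor_space_no_isolated by auto
qed

theorem theorem4p4:
  fixes X :: "'a topology"
  assumes "completely_metrizable_space X"
  shows "(cantor_partitionable X \<longleftrightarrow> cantor_coverable X) \<and>
         (cantor_coverable X \<longleftrightarrow> \<not> (\<exists>x. isolated_point X x))"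
proof -
  have "cantor_coverable X" if "cantor_partitionable X"
    using that unfolding cantor_partitionable_def cantor_coverable_def partition_on_def by blast
  moreover have "cantor_partitionable X" if iso: "\<not> (\<exists>x. isolated_point X x)"
  proof -
    obtain M d where "Metric_space M d" and compl: "Metric_space.mcomplete M d" and X: "X = Metric_space.mtopology M d"
      using assms unfolding completely_metrizable_space_def by blast
    interpret Metric_space M d by fact
    have "\<not> openin mtopology {x}" for x
      using iso openin_subset[of mtopology "{x}"] unfolding isolated_point_def X by auto
    then have "cantor_decomposable mtopology M" using cantor_decomposable_if_no_isolated compl by blast
    then show ?thesis unfolding cantor_partitionable_def cantor_decomposable_def X by simp
  qed
  ultimately show ?thesis using cantor_coverable_not_isolated[of X] by blast
qed

end
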